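(* (1) Consider the eight points in $\mathbb{R}^3$: $s=(0,0,0)$, $e=(1,0,0)$, $w=(0,1,0)$, $n=(1,1,0)$, $v_1=(-1,0,1)$, $v_2=(1,1,1)$, $u_1=(0,1,-1)$, $u_2=(2,0,-1)$. These eight points are the vertices of a polytope $P$ whose only integer points are precisely its eight vertices, and: (a) $P$ has a unique maximal dissection; it has $12$ tetrahedra, all of which are unimodular, i.e. have volume $1/6$; (b) the maximal triangulations of $P$ (of which there are several) have $11$ tetrahedra. (2) For the $3$-polytope with vertices $u_1=(1,0,0)$, $w=(1,0,1)$, $v_1=(-1,0,0)$, $s=(-1,0,-1)$, $v_2=(0,1,1)$, $n=(1,1,1)$, $u_2=(0,1,-1)$, $e=(-1,1,-1)$: there is a unique minimal dissection and it has size $6$; the minimal triangulations (of which there are several) have size $7$; the maximal triangulations (of which there are several) have size $9$; and there is a unique maximal dissection and it has size $10$.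
   Context: A dissection of a convex $3$-polytope $P$ is a set of tetrahedra whose vertices are among the vertices of $P$, such that no two of them have an interior point in common and their union is $P$. A dissection is a triangulation if any two of its tetrahedra intersect in a common face (possibly empty). The size of a dissection is its number of tetrahedra; maximal (minimal) means of maximum (minimum) size. "Several" means more than one. Integer points are points of $\mathbb{Z}^3$. *)

theory Defs
  imports "HOL-Analysis.Analysis"
begin

definition vertices_of :: "(real^3) set \<Rightarrow> (real^3) set" where
  "vertices_of P = {v. v extreme_point_of P}"

text \<open>
  A tetrahedron is a nondegenerate 3-simplex, given as a point set; it is full-dimensional, so
  the topological interior is the one meant. A polytope has finitely many
  vertices, so a dissection of it is automatically finite and \<open>card\<close> is its size.
\<close>

definition dissection :: "(real^3) set set \<Rightarrow> (real^3) set \<Rightarrow> bool" where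
  "dissection D P \<longleftrightarrow>
     (\<forall>T\<in>D. 3 simplex T \<and> vertices_of T \<subseteq> vertices_of P) \<and>
     pairwise (\<lambda>S T. interior S \<inter> interior T = {}) D \<and>
     \<Union>D = P"

text \<open>
  For a dissection, the library's \<open>triangulation\<close> adds exactly that the intersection of any two
  members is a face (possibly empty) of each. It does not mention the union or the vertices.
\<close>

definition triangulation_of :: "(real^3) set set \<Rightarrow> (real^3) set \<Rightarrow> bool" where
  "triangulation_of D P \<longleftrightarrow> dissection D P \<and> triangulation D"

text \<open>
  Maximal and minimal refer to size, not to inclusion; for triangulations they are taken among
  the triangulations of the polytope only.
\<close>

definition maximal_dissection :: "(real^3) set set \<Rightarrow> (real^3) set \<Rightarrow> bool" where
  "maximal_dissection D P \<longleftrightarrow> is_arg_max card (\<lambda>E. dissection E P) D"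

definition minimal_dissection :: "(real^3) set set \<Rightarrow> (real^3) set \<Rightarrow> bool" where
  "minimal_dissection D P \<longleftrightarrow> is_arg_min card (\<lambda>E. dissection E P) D"

definition maximal_triangulation :: "(real^3) set set \<Rightarrow> (real^3) set \<Rightarrow> bool" where
  "maximal_triangulation D P \<longleftrightarrow> is_arg_max card (\<lambda>E. triangulation_of E P) D"

definition minimal_triangulation :: "(real^3) set set \<Rightarrow> (real^3) set \<Rightarrow> bool" where
  "minimal_triangulation D P \<longleftrightarrow> is_arg_min card (\<lambda>E. triangulation_of E P) D"

definition several :: "('a \<Rightarrow> bool) \<Rightarrow> bool" where
  "several Q \<longleftrightarrow> (\<exists>x y. x \<noteq> y \<and> Q x \<and> Q y)"

definition integer_points :: "(real^3) set" where
  "integer_points = {x. \<forall>i. x $ i \<in> \<int>}"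

end

theory Submission
  imports Defs
begin

text \<open>
  Tetrahedra spanned by the eight points are given by integer data, and membership of a point in
  a tetrahedron is decided by the signs of its barycentric coordinates. A dissection covers every
  point that avoids all spanned planes exactly once, so a finite set of such probe points turns
  every dissection into a solution of an exact cover problem; solving it for suitable probes
  yields all the bounds on the size and the uniqueness of the extremal dissections.
  Conversely, tetrahedra that are pairwise separated by planes and whose volumes add up to that of
  the polytope form a dissection; if moreover the separating planes meet both tetrahedra exactly in
  the hull of their common vertices, they form a triangulation. The extremal dissections are not
  triangulations since two of their edges cross, at the centre of the parallelogram \<open>s e n w\<close>.
\<close>

subsection \<open>Signed volumes and barycentric coordinates\<close>

text \<open>An exact cover is only a necessary condition for a dissection: finitely many probes may
  miss an overlap, so spurious covers can occur. They do no harm as long as their size is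
  intermediate; only at the extremal sizes must every cover be a known dissection. Triangulations
  are never enumerated: the extremal dissections are unique and not triangulations, so the bounds
  for triangulations are sharper by one, and explicit triangulations attain them. In the first
  polytope 12 is also the ceiling set by volume, since the polytope has volume 12/6 and a lattice
  tetrahedron at least 1/6; the covers add the uniqueness. In the second one the volume 14/6 gives
  no sharp bound. To recognise a dissection, an upper bound on the volume of the polytope is enough.
  It comes from a covering by tetrahedra, through facet inequalities and subadditivity. Probes are
  scaled to integer points, so that the finite checks are integer computations done by
  \<open>code_simp\<close>.\<close>

type_synonym ipoint = "int \<times> int \<times> int"

fun emb :: "ipoint \<Rightarrow> real^3" where
  "emb (x, y, z) = vector [of_int x, of_int y, of_int z]"

fun dot3 :: "ipoint \<Rightarrow> ipoint \<Rightarrow> int" where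
  "dot3 (a, b, c) (x, y, z) = a * x + b * y + c * z"

fun smul :: "int \<Rightarrow> ipoint \<Rightarrow> ipoint" where
  "smul k (x, y, z) = (k * x, k * y, k * z)"

fun det3 :: "ipoint \<Rightarrow> ipoint \<Rightarrow> ipoint \<Rightarrow> int" where
  "det3 (a, b, c) (d, e, f) (g, h, i) = a * (e * i - f * h) - b * (d * i - f * g) + c * (d * h - e * g)"

text \<open>Six times the signed volume. The default 0 lets \<open>vol4 t \<noteq> 0\<close> express
  at once that \<open>t\<close> has four entries and that these are affinely independent.\<close>

fun vol4 :: "ipoint list \<Rightarrow> int" where
  "vol4 [a, b, c, d] = det3 (b - a) (c - a) (d - a)"
| "vol4 _ = 0"

definition orient :: "real^3 \<Rightarrow> real^3 \<Rightarrow> real^3 \<Rightarrow> real^3 \<Rightarrow> real" where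
  "orient a b c d = (b - a) \<bullet> cross3 (c - a) (d - a)"

abbreviation ihull :: "ipoint list \<Rightarrow> (real^3) set" where
  "ihull t \<equiv> convex hull (emb ` set t)"

lemma emb_component [simp]:
  "emb (x, y, z) $ 1 = of_int x" "emb (x, y, z) $ 2 = of_int y" "emb (x, y, z) $ 3 = of_int z"
  by simp_all

declare emb.simps [simp del]

lemma inj_emb: "inj emb"
  by (rule injI) (metis emb_component of_int_eq_iff prod_cases3)

lemma emb_eq_iff [simp]: "emb a = emb b \<longleftrightarrow> a = b"
  using inj_emb by (simp add: inj_eq)

lemma emb_smul: "emb (smul k a) = of_int k *\<^sub>R emb a"
  by (cases a) (simp add: vec_eq_iff forall_3)

lemma emb_dot: "emb a \<bullet> emb b = of_int (dot3 a b)"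
  by (cases a; cases b) (simp add: inner_vec_def sum_3)

lemma vol4_orient: "of_int (vol4 [a, b, c, d]) = orient (emb a) (emb b) (emb c) (emb d)"
  by (cases a; cases b; cases c; cases d)
    (simp add: orient_def cross3_def inner_vec_def sum_3 algebra_simps)

lemma vol4_nonzeroE:
  assumes "vol4 t \<noteq> 0"
  obtains a b c d where "t = [a, b, c, d]" "orient (emb a) (emb b) (emb c) (emb d) \<noteq> 0"
  using assms by (cases t rule: vol4.cases) (auto simp flip: vol4_orient simp del: vol4.simps(1))

text \<open>Cramer's rule with the denominator cleared, which makes it a polynomial identity in the
  coordinates.\<close>

lemma orient_barycentric:
  "orient a b c d *\<^sub>R x =
     orient x b c d *\<^sub>R a + orient a x c d *\<^sub>R b + orient a b x d *\<^sub>R c + orient a b c x *\<^sub>R d"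
  unfolding vec_eq_iff forall_3 orient_def
  by (simp add: cross3_def inner_vec_def sum_3 algebra_simps)

lemma orient_sum:
  "orient x b c d + orient a x c d + orient a b x d + orient a b c x = orient a b c d"
  unfolding orient_def by (simp add: cross3_def inner_vec_def sum_3 algebra_simps)

lemma orient_self [simp]:
  "orient a a c d = 0" "orient a b a d = 0" "orient a b c a = 0"
  "orient a b b d = 0" "orient a b c b = 0" "orient a b c c = 0"
  unfolding orient_def by (simp_all add: cross3_def inner_vec_def sum_3 algebra_simps)

text \<open>In point-normal form each coordinate describes a half-space; this gives
  \<open>bary_signs_convex\<close>.\<close>

lemma orient_affine:
  "orient x b c d = - cross3 (c - b) (d - b) \<bullet> (x - b)"
  "orient a x c d = cross3 (c - a) (d - a) \<bullet> (x - a)"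
  "orient a b x d = cross3 (d - a) (b - a) \<bullet> (x - a)"
  "orient a b c x = cross3 (b - a) (c - a) \<bullet> (x - a)"
  by (simp_all add: orient_def cross3_def inner_vec_def sum_3 algebra_simps)

text \<open>For a nondegenerate tetrahedron these are the barycentric coordinates of
  \<open>x\<close> times the square of \<open>orient a b c d\<close>: they have the right signs for
  either orientation, and no division leaves the integers.\<close>

definition bary_signs :: "real^3 \<Rightarrow> real^3 \<Rightarrow> real^3 \<Rightarrow> real^3 \<Rightarrow> real^3 \<Rightarrow> real set" where
  "bary_signs a b c d x = (\<lambda>r. orient a b c d * r) `
     {orient x b c d, orient a x c d, orient a b x d, orient a b c x}"

lemma bary_signs_convex: "convex {x. \<forall>r\<in>bary_signs a b c d x. 0 \<le> r}"
proof -
  have *: "convex {x. 0 \<le> p * (m \<bullet> (x - y))}" for p and m y :: "real^3"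
  proof -
    have "{x. 0 \<le> p * (m \<bullet> (x - y))} = {x. (p *\<^sub>R m) \<bullet> x \<ge> p * (m \<bullet> y)}"
      by (auto simp: algebra_simps)
    then show ?thesis by (simp only: convex_halfspace_ge)
  qed
  have half: "convex {x. 0 \<le> p * orient x b c d}" "convex {x. 0 \<le> p * orient a x c d}"
    "convex {x. 0 \<le> p * orient a b x d}" "convex {x. 0 \<le> p * orient a b c x}" for p
    by (subst orient_affine, rule *)+
  have "{x. \<forall>r\<in>bary_signs a b c d x. 0 \<le> r} =
      {x. 0 \<le> orient a b c d * orient x b c d} \<inter> {x. 0 \<le> orient a b c d * orient a x c d} \<inter>
      {x. 0 \<le> orient a b c d * orient a b x d} \<inter> {x. 0 \<le> orient a b c d * orient a b c x}"
    by (auto simp: bary_signs_def)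
  then show ?thesis
    by (simp only: convex_Int half)
qed

lemma bary_signs_open: "open {x. \<forall>r\<in>bary_signs a b c d x. 0 < r}"
proof -
  have "{x. \<forall>r\<in>bary_signs a b c d x. 0 < r} =
      {x. 0 < orient a b c d * orient x b c d} \<inter> {x. 0 < orient a b c d * orient a x c d} \<inter>
      {x. 0 < orient a b c d * orient a b x d} \<inter> {x. 0 < orient a b c d * orient a b c x}"
    by (auto simp: bary_signs_def)
  also have "open \<dots>"
    unfolding orient_def
    by (intro open_Int open_Collect_less continuous_intros continuous_on_cross)
  finally show ?thesis .
qed

text \<open>One inclusion is convexity of half-spaces. For the other,
  \<open>orient_barycentric\<close> divided by the orientation writes \<open>x\<close> as a convex
  combination.\<close>

lemma convex_hull_4:
  assumes "orient a b c d \<noteq> 0"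
  shows "convex hull {a, b, c, d} = {x. \<forall>r\<in>bary_signs a b c d x. 0 \<le> r}" (is "_ = ?S")
proof
  show "convex hull {a, b, c, d} \<subseteq> ?S"
    by (rule hull_minimal[where S = convex, OF _ bary_signs_convex]) (auto simp: bary_signs_def)
  show "?S \<subseteq> convex hull {a, b, c, d}"
  proof
    fix x assume x: "x \<in> ?S"
    define q where "q r = r / orient a b c d" for r
    have q0: "0 \<le> q r" if "0 \<le> orient a b c d * r" for r
      using that assms by (auto simp: q_def zero_le_divide_iff zero_le_mult_iff)
    have nn: "0 \<le> q (orient x b c d)" "0 \<le> q (orient a x c d)"
        "0 \<le> q (orient a b x d)" "0 \<le> q (orient a b c x)"
      using x by (auto simp: bary_signs_def intro!: q0)
    have sum1: "q (orient x b c d) + q (orient a x c d) + q (orient a b x d) + q (orient a b c x) = 1"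
      using orient_sum[of x b c d a] assms by (simp add: q_def flip: add_divide_distrib)
    have "x = (1 / orient a b c d) *\<^sub>R (orient a b c d *\<^sub>R x)"
      using assms by simp
    also have "\<dots> = q (orient x b c d) *\<^sub>R a + q (orient a x c d) *\<^sub>R b
        + q (orient a b x d) *\<^sub>R c + q (orient a b c x) *\<^sub>R d"
      unfolding orient_barycentric[of a b c d x] by (simp add: q_def scaleR_right_distrib)
    finally have xeq: "x = \<dots>" .
    define w where "w i = (if i = 0 then q (orient x b c d) else if i = 1 then q (orient a x c d)
      else if i = 2 then q (orient a b x d) else q (orient a b c x))" for i :: nat
    define p where "p i = (if i = 0 then a else if i = 1 then b else if i = 2 then c else d)" for i :: nat
    have "(\<Sum>i<4. w i *\<^sub>R p i) \<in> convex hull {a, b, c, d}"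
    proof (rule convex_sum)
      show "sum w {..<4} = 1"
        using sum1 by (simp add: w_def eval_nat_numeral)
      show "p i \<in> convex hull {a, b, c, d}" for i
        by (rule hull_inc) (auto simp: p_def)
      show "0 \<le> w i" for i using nn by (simp add: w_def)
    qed auto
    also have "(\<Sum>i<4. w i *\<^sub>R p i) = x"
      by (rule trans[OF _ xeq[symmetric]]) (simp add: w_def p_def eval_nat_numeral)
    finally show "x \<in> convex hull {a, b, c, d}" .
  qed
qed

lemma interior_convex_hull_4:
  assumes "orient a b c d \<noteq> 0" "\<forall>r\<in>bary_signs a b c d x. 0 < r"
  shows "x \<in> interior (convex hull {a, b, c, d})"
proof (rule interiorI)
  show "{x. \<forall>r\<in>bary_signs a b c d x. 0 < r} \<subseteq> convex hull {a, b, c, d}"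
    unfolding convex_hull_4[OF assms(1)] by (auto intro: less_imp_le)
qed (use assms bary_signs_open in auto)

lemma interior_convex_hull_4_nonempty:
  assumes "orient a b c d \<noteq> 0"
  shows "interior (convex hull {a, b, c, d}) \<noteq> {}"
proof -
  \<comment> \<open>The centroid: all four barycentric coordinates are 1/4.\<close>
  define x where "x = (1/4) *\<^sub>R (a + b + c + d)"
  have "orient x b c d = orient a b c d / 4" "orient a x c d = orient a b c d / 4"
     "orient a b x d = orient a b c d / 4" "orient a b c x = orient a b c d / 4"
    unfolding x_def orient_def by (simp_all add: cross3_def inner_vec_def sum_3 field_simps)
  then have "\<forall>r\<in>bary_signs a b c d x. 0 < r"
    using assms by (auto simp: bary_signs_def zero_less_mult_iff linorder_neq_iff)
  from interior_convex_hull_4[OF assms this] show ?thesis by auto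
qed

lemma affine_independent_4:
  assumes "orient a b c d \<noteq> 0"
  shows "\<not> affine_dependent {a, b, c, d}" "card {a, b, c, d} = 4"
proof -
  have "a \<noteq> b" "a \<noteq> c" "a \<noteq> d" "b \<noteq> c" "b \<noteq> d" "c \<noteq> d"
    using assms by auto
  then show "card {a, b, c, d} = 4" by simp
  then show "\<not> affine_dependent {a, b, c, d}"
    using aff_dim_nonempty_interior[OF interior_convex_hull_4_nonempty[OF assms]]
    by (simp add: affine_independent_iff_card aff_dim_convex_hull)
qed

text \<open>A vanishing determinant yields a nonzero kernel vector \<open>m\<close>, and the four
  points then lie in one plane normal to \<open>m\<close>.\<close>

lemma orient_nonzero:
  assumes "\<not> affine_dependent {a, b, c, d}" "card {a, b, c, d} = 4"
  shows "orient a b c d \<noteq> 0"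
proof
  assume "orient a b c d = 0"
  then have "det (vector [b - a, c - a, d - a] :: real^3^3) = 0"
    by (simp add: orient_def dot_cross_det)
  then obtain m where m: "m \<noteq> 0" "(vector [b - a, c - a, d - a] :: real^3^3) *v m = 0"
    using invertible_det_nz[of "vector [b - a, c - a, d - a] :: real^3^3"]
      invertible_left_inverse[of "vector [b - a, c - a, d - a] :: real^3^3"]
      matrix_left_invertible_ker[of "vector [b - a, c - a, d - a] :: real^3^3"]
    by blast
  then have "(b - a) \<bullet> m = 0" "(c - a) \<bullet> m = 0" "(d - a) \<bullet> m = 0"
    by (auto simp: vec_eq_iff forall_3 matrix_vector_mult_def inner_vec_def)
  then have "{a, b, c, d} \<subseteq> {x. m \<bullet> x = m \<bullet> a}"
    by (auto simp: inner_diff_left inner_diff_right inner_commute)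
  from aff_dim_subset[OF this] m(1) have "aff_dim {a, b, c, d} \<le> 2"
    by simp
  moreover have "aff_dim {a, b, c, d} = 3"
    using assms by (simp add: affine_independent_iff_card)
  ultimately show False by simp
qed

lemma measure_convex_hull_4:
  assumes "orient a b c d \<noteq> 0"
  shows "measure lebesgue (convex hull {a, b, c, d}) = \<bar>orient a b c d\<bar> / 6"
proof -
  define f :: "3 \<Rightarrow> real^3" where "f i = (if i = 1 then b else if i = 2 then c else d)" for i
  have ne: "a \<noteq> b" "a \<noteq> c" "a \<noteq> d" "b \<noteq> c" "b \<noteq> d" "c \<noteq> d"
    using assms by auto
  have f: "f 1 = b" "f 2 = c" "f 3 = d" by (simp_all add: f_def)
  have "bij_betw f UNIV ({a, b, c, d} - {a})"
    unfolding bij_betw_def inj_def UNIV_3 using ne by (auto simp: f)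
  then have "measure lborel (convex hull {a, b, c, d}) = \<bar>det (\<chi> i j. f j $ i - a $ i)\<bar> / fact CARD(3)"
    using ne by (intro content_simplex) auto
  also have "det (\<chi> i j. f j $ i - a $ i) = orient a b c d"
    by (simp add: det_3 f orient_def cross3_def inner_vec_def sum_3 algebra_simps)
  finally show ?thesis
    by (simp add: fact_numeral measure_completion compact_imp_closed finite_imp_compact_convex_hull borel_closed)
qed

section \<open>Hulls of integer lists and the candidate tetrahedra\<close>

lemma ihull_4: "ihull [a, b, c, d] = convex hull {emb a, emb b, emb c, emb d}"
  by simp

lemma convex_ihull [simp]: "convex (ihull t)"
  by simp

lemma compact_ihull [simp]: "compact (ihull t)"
  by (simp add: finite_imp_compact_convex_hull)

lemma ihull_lmeasurable [simp]: "ihull t \<in> lmeasurable"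
  by (simp add: lmeasurable_compact)

lemma ihull_mono: "set t \<subseteq> set V \<Longrightarrow> ihull t \<subseteq> ihull V"
  by (simp add: hull_mono image_mono)

lemma vol4_affine_independent:
  assumes "vol4 t \<noteq> 0"
  shows "\<not> affine_dependent (emb ` set t)" "card (emb ` set t) = 4"
  using assms by (auto elim!: vol4_nonzeroE dest: affine_independent_4)

lemma vol4_simplex: "vol4 t \<noteq> 0 \<Longrightarrow> 3 simplex ihull t"
  unfolding simplex_def using vol4_affine_independent by force

lemma vol4_vertices: "vol4 t \<noteq> 0 \<Longrightarrow> vertices_of (ihull t) = emb ` set t"
  by (simp add: vertices_of_def extreme_point_of_convex_hull_affine_independent vol4_affine_independent)

lemma vol4_interior: "vol4 t \<noteq> 0 \<Longrightarrow> interior (ihull t) \<noteq> {}"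
  by (auto elim!: vol4_nonzeroE dest: interior_convex_hull_4_nonempty)

lemma vol4_measure: "vol4 t \<noteq> 0 \<Longrightarrow> measure lebesgue (ihull t) = \<bar>of_int (vol4 t)\<bar> / 6"
  by (erule vol4_nonzeroE, hypsubst) (simp only: ihull_4 vol4_orient, rule measure_convex_hull_4)

text \<open>Subsequences keep the order of \<open>V\<close>, so that for distinct \<open>V\<close>
  each tetrahedron is represented by exactly one list.\<close>

definition tets :: "ipoint list \<Rightarrow> ipoint list list" where
  "tets V = filter (\<lambda>t. vol4 t \<noteq> 0) (subseqs V)"

lemma tetsD:
  assumes "t \<in> set (tets V)"
  shows "vol4 t \<noteq> 0" "set t \<subseteq> set V"
proof -
  have t: "t \<in> set (subseqs V)" "vol4 t \<noteq> 0"
    using assms by (simp_all add: tets_def)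
  then show "vol4 t \<noteq> 0" by blast
  from t(1) have "set t \<in> set ` set (subseqs V)"
    by (rule imageI)
  then show "set t \<subseteq> set V"
    unfolding subseqs_powset by (rule PowD)
qed

text \<open>A simplex determines its vertices, and a subsequence of a distinct list is determined by
  its set of entries.\<close>

lemma inj_on_ihull_tets:
  assumes "distinct V"
  shows "inj_on ihull (set (tets V))"
proof (rule inj_onI)
  fix t t' assume t: "t \<in> set (tets V)" "t' \<in> set (tets V)" and eq: "ihull t = ihull t'"
  have "emb ` set t = emb ` set t'"
    using vol4_vertices[OF tetsD(1)[OF t(1)]] vol4_vertices[OF tetsD(1)[OF t(2)]]
    unfolding eq by (rule trans[OF sym])
  then have "set t = set t'"
    using inj_emb by (simp add: inj_image_eq_iff)
  moreover have "inj_on set (set (subseqs V))"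
    using distinct_set_subseqs[OF assms] by (simp add: distinct_map)
  ultimately show "t = t'"
    using t by (auto simp: tets_def inj_on_def)
qed

lemma simplex_in_tets:
  assumes "distinct V" "3 simplex T" "vertices_of T \<subseteq> emb ` set V"
  shows "T \<in> ihull ` set (tets V)"
proof -
  obtain C where C: "\<not> affine_dependent C" "card C = 4" "T = convex hull C"
    using assms(2) by (auto simp: simplex_def)
  then have "vertices_of T = C"
    by (simp add: vertices_of_def extreme_point_of_convex_hull_affine_independent)
  with assms(3) obtain B where "B \<subseteq> set V" and B: "C = emb ` B"
    by (metis subset_imageE)
  then obtain t where t: "t \<in> set (subseqs V)" "set t = B"
    using subset_subseqs by blast
  then have "distinct t"
    using assms(1) by (simp add: subseqs_distinctD)
  moreover have "card B = 4"
    using C(2) B card_image[OF inj_on_subset[OF inj_emb subset_UNIV, of B]] by simp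
  ultimately have "length t = 4"
    using t(2) distinct_card by fastforce
  then obtain a b c d where abcd: "t = [a, b, c, d]"
    by (auto simp: eval_nat_numeral length_Suc_conv)
  have "emb ` B = {emb a, emb b, emb c, emb d}"
    using t(2) abcd by auto
  then have "vol4 t \<noteq> 0"
    using orient_nonzero[of "emb a" "emb b" "emb c" "emb d"] C(1,2) B abcd
    by (metis of_int_0 vol4_orient)
  with t C(3) B show ?thesis
    by (auto simp: tets_def)
qed

lemma ihull_4_iff:
  assumes "vol4 [a, b, c, d] \<noteq> 0"
  shows "x \<in> ihull [a, b, c, d] \<longleftrightarrow>
    (\<forall>r\<in>bary_signs (emb a) (emb b) (emb c) (emb d) x. 0 \<le> r)"
  using assms convex_hull_4[of "emb a" "emb b" "emb c" "emb d"]
  by (simp flip: vol4_orient del: vol4.simps)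

lemmas ihull_4_ineqs = ihull_4_iff bary_signs_def orient_def cross3_def inner_vec_def sum_3

subsection \<open>Dissections as exact covers of probe points\<close>

fun barys :: "ipoint list \<Rightarrow> ipoint \<Rightarrow> int list" where
  "barys [a, b, c, d] x = [vol4 [x, b, c, d], vol4 [a, x, c, d], vol4 [a, b, x, d], vol4 [a, b, c, x]]"
| "barys _ x = []"

definition strictly_inside :: "ipoint list \<Rightarrow> ipoint \<Rightarrow> bool" where
  "strictly_inside t x = list_all (\<lambda>r. 0 < vol4 t * r) (barys t x)"

text \<open>For a nondegenerate \<open>t\<close>, being neither strictly inside nor strictly outside
  means lying on the boundary. Only this is excluded by \<open>generic\<close> below; a probe in the
  plane of a facet but beyond that facet is allowed.\<close>

definition strictly_outside :: "ipoint list \<Rightarrow> ipoint \<Rightarrow> bool" where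
  "strictly_outside t x = list_ex (\<lambda>r. vol4 t * r < 0) (barys t x)"

lemma orient_scale:
  "orient (k *\<^sub>R a) (k *\<^sub>R b) (k *\<^sub>R c) (k *\<^sub>R d) = k ^ 3 * orient a b c d"
  by (simp add: orient_def cross_mult_left cross_mult_right power3_eq_cube flip: scaleR_right_diff_distrib)

lemma bary_signs_barys:
  "bary_signs (emb a) (emb b) (emb c) (emb d) (emb x) =
     of_int ` (\<lambda>r. vol4 [a, b, c, d] * r) ` set (barys [a, b, c, d] x)"
  by (simp add: bary_signs_def vol4_orient del: vol4.simps)

lemma bary_signs_scale:
  "bary_signs (k *\<^sub>R a) (k *\<^sub>R b) (k *\<^sub>R c) (k *\<^sub>R d) (k *\<^sub>R x) = (\<lambda>r. k ^ 6 * r) ` bary_signs a b c d x"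
  by (auto simp: bary_signs_def orient_scale algebra_simps simp flip: power_add)

text \<open>Tetrahedron and point are both enlarged by \<open>k\<close> to keep the test integral.
  An entry of \<open>bary_signs\<close> is a product of two volumes, so it is multiplied by
  \<open>k ^ 6\<close>, which preserves its sign.\<close>

lemma strictly_scaled:
  assumes "vol4 t \<noteq> 0" "0 < k"
  shows "strictly_inside (map (smul k) t) x \<Longrightarrow> emb x /\<^sub>R of_int k \<in> interior (ihull t)"
    and "strictly_outside (map (smul k) t) x \<Longrightarrow> emb x /\<^sub>R of_int k \<notin> ihull t"
proof -
  obtain a b c d where t: "t = [a, b, c, d]" and nz: "orient (emb a) (emb b) (emb c) (emb d) \<noteq> 0"
    using assms(1) by (rule vol4_nonzeroE)
  define p where "p = emb x /\<^sub>R of_int k"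
  have p: "emb x = of_int k *\<^sub>R p"
    using assms(2) by (simp add: p_def)
  let ?t = "map (smul k) t"
  have eq: "(\<lambda>r. of_int k ^ 6 * r) ` bary_signs (emb a) (emb b) (emb c) (emb d) p =
      of_int ` (\<lambda>r. vol4 ?t * r) ` set (barys ?t x)"
    using bary_signs_barys[of "smul k a" "smul k b" "smul k c" "smul k d" x]
    unfolding emb_smul p bary_signs_scale t by simp
  have k6: "0 < (of_int k :: real) ^ 6"
    using assms(2) by simp
  have "\<forall>r\<in>bary_signs (emb a) (emb b) (emb c) (emb d) p. 0 < r"
    if "strictly_inside ?t x"
  proof -
    have "\<forall>r\<in>of_int ` (\<lambda>r. vol4 ?t * r) ` set (barys ?t x). 0 < (r :: real)"
      using that by (auto simp: strictly_inside_def list_all_iff)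
    then show ?thesis
      unfolding eq[symmetric] using k6 by (simp add: zero_less_mult_iff)
  qed
  then show "emb x /\<^sub>R of_int k \<in> interior (ihull t)" if "strictly_inside ?t x"
    using that interior_convex_hull_4[OF nz] unfolding t p_def[symmetric] ihull_4 by blast
  have "\<exists>r\<in>bary_signs (emb a) (emb b) (emb c) (emb d) p. r < 0"
    if "strictly_outside ?t x"
  proof -
    have "\<exists>r\<in>of_int ` (\<lambda>r. vol4 ?t * r) ` set (barys ?t x). (r :: real) < 0"
      using that by (auto simp: strictly_outside_def list_ex_iff)
    then show ?thesis
      unfolding eq[symmetric] using k6 by (simp add: mult_less_0_iff)
  qed
  then show "emb x /\<^sub>R of_int k \<notin> ihull t" if "strictly_outside ?t x"
    using that unfolding t p_def[symmetric] ihull_4 convex_hull_4[OF nz] by force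
qed

text \<open>The probe points are \<open>x / k\<close> for the integer points \<open>x\<close> in the list \<open>X\<close>.\<close>

definition generic :: "int \<Rightarrow> ipoint list \<Rightarrow> ipoint list \<Rightarrow> bool" where
  "generic k V X = list_all (\<lambda>t. list_all (\<lambda>x. strictly_inside t x \<or> strictly_outside t x) X)
     (map (map (smul k)) (tets V))"

section \<open>Incidence tables and the enumeration of exact covers\<close>

definition incidence :: "int \<Rightarrow> ipoint list \<Rightarrow> ipoint list \<Rightarrow> (ipoint list \<times> bool list) list" where
  "incidence k V X = map (\<lambda>t. (t, map (strictly_inside (map (smul k) t)) X)) (tets V)"

text \<open>The nested conditionals let evaluation stop at the first common point.\<close>

fun disj :: "bool list \<Rightarrow> bool list \<Rightarrow> bool" where
  "disj (p # ps) (q # qs) = (if p then (if q then False else disj ps qs) else disj ps qs)"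
| "disj _ _ = True"

lemma disj_iff: "length p = length q \<Longrightarrow> disj p q \<longleftrightarrow> (\<forall>i<length p. \<not> (p ! i \<and> q ! i))"
  by (induction p q rule: list_induct2) (auto simp: less_Suc_eq_0_disj)

text \<open>
  \<open>covers u ts\<close> enumerates the sets of labels in \<open>ts\<close> whose rows partition \<open>u\<close>. The head entry of
  every remaining row is \<open>False\<close> once the first point is dealt with, so that it can be dropped.
\<close>

fun covers :: "bool list \<Rightarrow> ('a \<times> bool list) list \<Rightarrow> 'a list list" where
  "covers [] ts = [[]]"
| "covers (b # u) ts =
     (if b then concat (map (\<lambda>(t, q). if hd q
        then map (Cons t) (covers (map2 (\<lambda>a b. a \<and> \<not> b) u (tl q))
          (map (apsnd tl) (filter (\<lambda>(t', q'). disj q q') ts)))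
        else []) ts)
      else covers u (map (apsnd tl) ts))"

text \<open>A \<open>True\<close> in every row forces an exact cover of \<open>[]\<close> to be
  empty, which is the base case of the enumeration. Injectivity on labels makes counting labels the
  same as counting rows.\<close>

definition exact_cover :: "('a \<times> bool list) set \<Rightarrow> bool list \<Rightarrow> bool" where
  "exact_cover D u \<longleftrightarrow> finite D \<and> inj_on fst D \<and>
     (\<forall>d\<in>D. length (snd d) = length u \<and> True \<in> set (snd d)) \<and>
     (\<forall>i<length u. u ! i \<longleftrightarrow> (\<exists>d\<in>D. snd d ! i)) \<and>
     pairwise (\<lambda>d d'. disj (snd d) (snd d')) D"

text \<open>When the first point is not to be covered, all head entries are \<open>False\<close> and
  carry no information. The labels stay put, which preserves injectivity and cardinality.\<close>

lemma exact_cover_tl: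
  assumes "exact_cover D (False # u)"
  shows "exact_cover (apsnd tl ` D) u" "fst ` apsnd tl ` D = fst ` D" "card (apsnd tl ` D) = card D"
proof -
  have inj: "inj_on fst D" and fin: "finite D"
    using assms by (auto simp: exact_cover_def)
  have Cons: "snd d = False # tl (snd d)" if "d \<in> D" for d
  proof -
    have "length (snd d) = Suc (length u)" "\<not> snd d ! 0"
      using assms that by (auto simp: exact_cover_def)
    then show ?thesis by (cases "snd d") auto
  qed
  have len: "length (tl (snd d)) = length u" if "d \<in> D" for d
    using assms that by (auto simp: exact_cover_def)
  show "fst ` apsnd tl ` D = fst ` D"
    by (force simp: image_image)
  show "card (apsnd tl ` D) = card D"
    by (rule card_image, rule inj_on_imageI2[of fst]) (simp add: inj)
  have "inj_on fst (apsnd tl ` D)"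
    by (rule inj_on_imageI) (simp add: inj)
  moreover have "True \<in> set (tl (snd d))" if "d \<in> D" for d
    using assms that Cons[OF that] by (metis exact_cover_def set_ConsD)
  moreover have "u ! i \<longleftrightarrow> (\<exists>d\<in>D. tl (snd d) ! i)" if "i < length u" for i
  proof -
    have "(False # u) ! Suc i \<longleftrightarrow> (\<exists>d\<in>D. snd d ! Suc i)"
      using assms that unfolding exact_cover_def by (metis Suc_less_eq length_Cons)
    also have "\<dots> \<longleftrightarrow> (\<exists>d\<in>D. tl (snd d) ! i)"
      using Cons by (metis nth_Cons_Suc)
    finally show ?thesis by simp
  qed
  moreover have "disj (tl (snd d)) (tl (snd d'))" if "d \<in> D" "d' \<in> D" "d \<noteq> d'" for d d'
  proof -
    have "disj (snd d) (snd d')"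
      using assms that by (auto simp: exact_cover_def pairwise_def)
    then show ?thesis
      by (subst (asm) Cons[OF that(1)], subst (asm) Cons[OF that(2)]) simp
  qed
  then have "pairwise (\<lambda>d d'. disj (snd d) (snd d')) (apsnd tl ` D)"
    unfolding pairwise_def by (smt (verit, best) imageE snd_apsnd)
  ultimately show "exact_cover (apsnd tl ` D) u"
    using len fin by (simp add: exact_cover_def)
qed

text \<open>The rows are disjoint, so taking one away subtracts exactly its points from the union.
  The head turns \<open>False\<close> because the removed row was the one that covered it.\<close>

lemma exact_cover_remove:
  assumes "exact_cover D (True # u)" "(t, True # q) \<in> D"
  shows "exact_cover (D - {(t, True # q)}) (False # map2 (\<lambda>a b. a \<and> \<not> b) u q)"
    "\<forall>d\<in>D - {(t, True # q)}. disj (True # q) (snd d)"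
proof -
  show dj: "\<forall>d\<in>D - {(t, True # q)}. disj (True # q) (snd d)"
    using assms by (force simp: exact_cover_def pairwise_def)
  have len: "length q = length u" "\<And>d. d \<in> D \<Longrightarrow> length (snd d) = Suc (length u)"
    using assms by (force simp: exact_cover_def)+
  have "(False # map2 (\<lambda>a b. a \<and> \<not> b) u q) ! i \<longleftrightarrow> (\<exists>d\<in>D - {(t, True # q)}. snd d ! i)"
    if "i < Suc (length u)" for i
  proof -
    have *: "\<not> ((True # q) ! i \<and> snd d ! i)" if "d \<in> D - {(t, True # q)}" for d
      using dj that len \<open>i < Suc (length u)\<close> by (auto simp: disj_iff)
    have "(False # map2 (\<lambda>a b. a \<and> \<not> b) u q) ! i \<longleftrightarrow> (True # u) ! i \<and> \<not> (True # q) ! i"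
      using that len(1) by (cases i) auto
    also have "(True # u) ! i \<longleftrightarrow> (\<exists>d\<in>D. snd d ! i)"
      using assms(1) that by (simp add: exact_cover_def)
    finally show ?thesis
      using * assms(2) by fastforce
  qed
  moreover have "inj_on fst (D - {(t, True # q)})"
    using assms(1) by (auto simp: exact_cover_def intro: inj_on_diff)
  ultimately show "exact_cover (D - {(t, True # q)}) (False # map2 (\<lambda>a b. a \<and> \<not> b) u q)"
    using assms(1) len by (auto simp: exact_cover_def pairwise_def)
qed

text \<open>Only completeness is claimed: no exact cover is missed, up to the order of its labels.
  The branch of \<open>covers\<close> to follow is given by the unique row of \<open>D\<close> that
  contains the first point.\<close>

lemma covers_complete:
  assumes "exact_cover D u" "D \<subseteq> set ts"
  shows "\<exists>c\<in>set (covers u ts). set c = fst ` D \<and> length c = card D"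
  using assms
proof (induction "length u" arbitrary: u D ts)
  case 0
  then have "D = {}" by (fastforce simp: exact_cover_def)
  with 0 show ?case by simp
next
  case (Suc n)
  then obtain b v where u: "u = b # v" and v: "length v = n"
    by (metis length_Suc_conv)
  \<comment> \<open>Dropping a \<open>False\<close> head is common to both cases: immediately if the
    first point is not asked for, otherwise after removing the row that covers it.\<close>
  have step: "\<exists>c\<in>set (covers w (map (apsnd tl) rs)). set c = fst ` E \<and> length c = card E"
    if "exact_cover E (False # w)" "E \<subseteq> set rs" "length w = n" for E w and rs :: "('a \<times> bool list) list"
    using Suc.hyps(1)[of w "apsnd tl ` E" "map (apsnd tl) rs"] exact_cover_tl[OF that(1)] that(2,3)
    by (metis image_mono set_map)
  show ?case
  proof (cases b)
    case False
    with step[of D v ts] Suc.prems u v show ?thesis by simp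
  next
    case True
    then obtain d where d: "d \<in> D" "snd d ! 0"
      using Suc.prems(1) u by (auto simp: exact_cover_def dest: spec[of _ 0])
    then obtain t q where tq: "d = (t, True # q)" and lq: "length q = length v"
    proof -
      have "length (snd d) = Suc (length v)"
        using Suc.prems(1) u d(1) by (simp add: exact_cover_def)
      with d(2) that[of "fst d" "tl (snd d)"] show ?thesis
        by (cases d; cases "snd d") auto
    qed
    let ?E = "D - {(t, True # q)}" and ?w = "map2 (\<lambda>a b. a \<and> \<not> b) v q"
    let ?rs = "filter (\<lambda>(t', q'). disj (True # q) q') ts"
    have rem: "exact_cover ?E (False # ?w)" "\<forall>d\<in>?E. disj (True # q) (snd d)"
      using exact_cover_remove[of D v t q] Suc.prems(1) True u d(1) tq by auto
    have "?E \<subseteq> set ?rs"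
      using rem(2) Suc.prems(2) by (simp add: subset_eq case_prod_beta)
    with step[OF rem(1) this] lq v obtain c where
      c: "c \<in> set (covers ?w (map (apsnd tl) ?rs))" "set c = fst ` ?E" "length c = card ?E"
      by auto
    have fin: "finite D" using Suc.prems(1) by (simp add: exact_cover_def)
    have "t # c \<in> set (covers u ts)"
    proof -
      have "(t, True # q) \<in> set ts"
        using d(1) tq Suc.prems(2) by auto
      then show ?thesis
        unfolding u covers.simps using True c(1) by (simp, intro bexI[of _ "(t, True # q)"]) auto
    qed
    moreover have "set (t # c) = fst ` D"
      using c(2) d(1) tq by force
    moreover have "length (t # c) = card D"
      using c(3) d(1) tq card_Suc_Diff1[OF fin, of d] by simp
    ultimately show ?thesis by blast
  qed
qed

text \<open>By genericity a probe in a tetrahedron lies in its interior. So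
  \<open>\<Union>D = P\<close> covers each probe at least once, and disjoint interiors cover it at
  most once. \<open>cols\<close> places every probe in the polytope; \<open>rows\<close> makes every
  tetrahedron visible to some probe.\<close>

lemma dissection_in_covers:
  assumes V: "distinct V" "vertices_of (ihull V) = emb ` set V"
    and k: "0 < k" and gen: "generic k V X"
    and rows: "list_all (\<lambda>(t, q). True \<in> set q) (incidence k V X)"
    and cols: "list_all (\<lambda>i. list_ex (\<lambda>(t, q). q ! i) (incidence k V X)) [0..<length X]"
    and D: "dissection D (ihull V)"
  shows "\<exists>c\<in>set (covers (map (\<lambda>_. True) X) (incidence k V X)). D = ihull ` set c \<and> card D = length c"
proof -
  define pt where "pt i = emb (X ! i) /\<^sub>R of_int k" for i
  define row where "row t = map (strictly_inside (map (smul k) t)) X" for t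
  have inc: "set (incidence k V X) = (\<lambda>t. (t, row t)) ` set (tets V)"
    by (simp add: incidence_def row_def)
  have row: "row t ! i \<longleftrightarrow> pt i \<in> ihull t" "row t ! i \<longleftrightarrow> pt i \<in> interior (ihull t)"
    if "t \<in> set (tets V)" "i < length X" for t i
  proof -
    have "strictly_inside (map (smul k) t) (X ! i) \<or> strictly_outside (map (smul k) t) (X ! i)"
      using gen that by (auto simp: generic_def list_all_iff)
    then show "row t ! i \<longleftrightarrow> pt i \<in> ihull t" "row t ! i \<longleftrightarrow> pt i \<in> interior (ihull t)"
      using strictly_scaled[OF tetsD(1)[OF that(1)] k, of "X ! i"] that(2) interior_subset
      by (auto simp: row_def pt_def)
  qed
  define E where "E = {t \<in> set (tets V). ihull t \<in> D}"
  have DE: "D = ihull ` E"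
  proof
    show "D \<subseteq> ihull ` E"
    proof
      fix T assume T: "T \<in> D"
      then have "T \<in> ihull ` set (tets V)"
        using D V(2) by (intro simplex_in_tets[OF V(1)]) (auto simp: dissection_def)
      with T show "T \<in> ihull ` E" by (auto simp: E_def)
    qed
  qed (auto simp: E_def)
  let ?E = "(\<lambda>t. (t, row t)) ` E"
  have exact: "exact_cover ?E (map (\<lambda>_. True) X)"
    unfolding exact_cover_def
  proof (intro conjI ballI allI impI)
    show "finite ?E" by (simp add: E_def)
    show "inj_on fst ?E" by (auto simp: inj_on_def)
    show "length (snd d) = length (map (\<lambda>_. True) X)" if "d \<in> ?E" for d
      using that by (auto simp: row_def)
    show "True \<in> set (snd d)" if "d \<in> ?E" for d
      using that rows by (auto simp: list_all_iff inc E_def)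
    show "map (\<lambda>_. True) X ! i \<longleftrightarrow> (\<exists>d\<in>?E. snd d ! i)" if "i < length (map (\<lambda>_. True) X)" for i
    proof -
      have i: "i < length X" using that by simp
      then have "list_ex (\<lambda>(t, q). q ! i) (incidence k V X)"
        using cols by (auto simp: list_all_iff)
      then obtain t where "t \<in> set (tets V)" "row t ! i"
        by (auto simp: list_ex_iff inc)
      then have "pt i \<in> ihull V"
        using row(1) i ihull_mono tetsD(2) by blast
      also have "ihull V = \<Union>D"
        using D by (simp add: dissection_def)
      finally obtain t' where "t' \<in> E" "pt i \<in> ihull t'"
        using DE by auto
      then show ?thesis
        using row(1)[of t' i] i by (auto simp: E_def)
    qed
    show "pairwise (\<lambda>d d'. disj (snd d) (snd d')) ?E"
    proof (rule pairwise_imageI)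
      fix t t' assume t: "t \<in> E" "t' \<in> E" "t \<noteq> t'"
      then have "ihull t \<noteq> ihull t'"
        using inj_on_ihull_tets[OF V(1)] by (auto simp: E_def inj_on_def)
      then have "interior (ihull t) \<inter> interior (ihull t') = {}"
        using D t unfolding dissection_def pairwise_def E_def by auto
      then have "\<not> (row t ! i \<and> row t' ! i)" if "i < length X" for i
        using row(2)[of t i] row(2)[of t' i] that t by (auto simp: E_def)
      then show "disj (snd (t, row t)) (snd (t', row t'))"
        by (simp add: disj_iff row_def)
    qed
  qed
  have "?E \<subseteq> set (incidence k V X)"
    by (auto simp: inc E_def)
  from covers_complete[OF exact this] obtain c where c: "c \<in> set (covers (map (\<lambda>_. True) X) (incidence k V X))"
      "set c = fst ` ?E" "length c = card ?E"
    by blast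
  moreover have "card ?E = card E"
    by (rule card_image) (auto simp: inj_on_def)
  moreover have "card D = card E"
    unfolding DE by (rule card_image) (rule inj_on_subset[OF inj_on_ihull_tets[OF V(1)]], simp add: E_def)
  moreover have "fst ` ?E = E" by force
  ultimately show ?thesis
    using DE by auto
qed

text \<open>The table is a single argument shared by the three tests, so that evaluation can compute
  it once.\<close>

definition table_check :: "(ipoint list list \<Rightarrow> bool) \<Rightarrow> nat \<Rightarrow> (ipoint list \<times> bool list) list \<Rightarrow> bool" where
  "table_check Q m ts \<longleftrightarrow> list_all (\<lambda>(t, q). True \<in> set q) ts \<and>
     list_all (\<lambda>i. list_ex (\<lambda>(t, q). q ! i) ts) [0..<m] \<and>
     list_all Q (covers (replicate m True) ts)"

text \<open>Covers of size strictly between \<open>lo\<close> and \<open>hi\<close> pass unexamined.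
  For the others, inclusion in some \<open>E\<close> of equal length is tested;
  \<open>dissection_sizes\<close> turns it into equality by counting.\<close>

definition size_check :: "ipoint list list list \<Rightarrow> nat \<Rightarrow> nat \<Rightarrow> ipoint list list \<Rightarrow> bool" where
  "size_check Es lo hi c \<longleftrightarrow> lo < length c \<and> length c < hi \<or>
     list_ex (\<lambda>E. length c = length E \<and> list_all (\<lambda>t. t \<in> set E) c) Es"

lemma dissection_sizes:
  assumes V: "distinct V" "vertices_of (ihull V) = emb ` set V"
    and k: "0 < k" "generic k V X"
    and table: "table_check (size_check Es lo hi) (length X) (incidence k V X)"
    and Es: "\<And>E. E \<in> set Es \<Longrightarrow> card (ihull ` set E) = length E"
    and D: "dissection D (ihull V)"
  shows "lo < card D \<and> card D < hi \<or> (\<exists>E\<in>set Es. D = ihull ` set E)"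
proof -
  have eq: "map (\<lambda>_. True) X = replicate (length X) True"
    by (simp add: map_replicate_const)
  obtain c where c: "c \<in> set (covers (replicate (length X) True) (incidence k V X))"
      "D = ihull ` set c" "card D = length c"
    using dissection_in_covers[OF V k _ _ D] table unfolding eq table_check_def by blast
  then have "size_check Es lo hi c"
    using table by (simp add: table_check_def list_all_iff)
  then consider "lo < length c \<and> length c < hi"
    | E where "E \<in> set Es" "length c = length E" "set c \<subseteq> set E"
    by (auto simp: size_check_def list_ex_iff list_all_iff)
  then show ?thesis
  proof cases
    case 1
    then show ?thesis using c(3) by simp
  next
    case 2
    have "D = ihull ` set E"
      using c Es[OF 2(1)] 2(2,3) by (intro card_seteq) auto
    with 2(1) show ?thesis by blast
  qed
qed

subsection \<open>Recognising dissections and triangulations\<close>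

definition separates :: "ipoint \<Rightarrow> ipoint list \<Rightarrow> ipoint list \<Rightarrow> bool" where
  "separates f t t' = list_all (\<lambda>v. list_all (\<lambda>u. dot3 f u \<le> dot3 f v) t') t"

text \<open>A tie means that \<open>u\<close> and \<open>v\<close> both lie on a separating plane.
  Both must then be common vertices, so either the two lists have the same vertices on that plane or
  they are strictly apart.\<close>

definition separates_properly :: "ipoint \<Rightarrow> ipoint list \<Rightarrow> ipoint list \<Rightarrow> bool" where
  "separates_properly f t t' = list_all (\<lambda>v. list_all (\<lambda>u. dot3 f u < dot3 f v \<or>
     dot3 f u = dot3 f v \<and> u \<in> set t \<and> v \<in> set t') t') t"

text \<open>Both orders are tried, so that one functional also stands for its negative.\<close>

fun separable :: "(ipoint \<Rightarrow> ipoint list \<Rightarrow> ipoint list \<Rightarrow> bool) \<Rightarrow> ipoint list \<Rightarrow>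
    ipoint list \<Rightarrow> ipoint list \<Rightarrow> bool" where
  "separable R [] t t' = False"
| "separable R (f # fs) t t' =
     (if R f t t' then True else if R f t' t then True else separable R fs t t')"

lemma separable_iff: "separable R fs t t' \<longleftrightarrow> (\<exists>f\<in>set fs. R f t t' \<or> R f t' t)"
  by (induction fs) auto

lemma separating_value:
  assumes "separates f t t'" "t \<noteq> []"
  obtains c where "\<forall>v\<in>set t. c \<le> dot3 f v" "\<forall>u\<in>set t'. dot3 f u \<le> c" "\<exists>v\<in>set t. dot3 f v = c"
proof
  have fin: "finite (dot3 f ` set t)" "dot3 f ` set t \<noteq> {}"
    using assms(2) by auto
  let ?c = "Min (dot3 f ` set t)"
  show "\<forall>v\<in>set t. ?c \<le> dot3 f v"
    by simp
  show "\<exists>v\<in>set t. dot3 f v = ?c"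
    using Min_in[OF fin] by force
  then show "\<forall>u\<in>set t'. dot3 f u \<le> ?c"
    using assms(1) by (auto simp: separates_def list_all_iff)
qed

lemma ihull_halfspace_ge:
  "\<forall>v\<in>set t. c \<le> dot3 f v \<Longrightarrow> ihull t \<subseteq> {x. emb f \<bullet> x \<ge> of_int c}"
  by (rule hull_minimal[where S = convex, OF _ convex_halfspace_ge]) (auto simp: emb_dot)

lemma ihull_halfspace_le:
  "\<forall>v\<in>set t. dot3 f v \<le> c \<Longrightarrow> ihull t \<subseteq> {x. emb f \<bullet> x \<le> of_int c}"
  by (rule hull_minimal[where S = convex, OF _ convex_halfspace_le]) (auto simp: emb_dot)

lemma separates_interior_disjoint:
  assumes "separates f t t'" "t \<noteq> []" "f \<noteq> (0, 0, 0)"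
  shows "interior (ihull t) \<inter> interior (ihull t') = {}"
proof -
  obtain c where c: "\<forall>v\<in>set t. c \<le> dot3 f v" "\<forall>u\<in>set t'. dot3 f u \<le> c"
      "\<exists>v\<in>set t. dot3 f v = c"
    by (rule separating_value[OF assms(1,2)])
  have "emb f \<noteq> 0"
    using assms(3) by (cases f) (auto simp: vec_eq_iff forall_3)
  then have "interior (ihull t) \<subseteq> {x. emb f \<bullet> x > of_int c}"
    "interior (ihull t') \<subseteq> {x. emb f \<bullet> x < of_int c}"
    using interior_mono[OF ihull_halfspace_ge[OF c(1)]] interior_mono[OF ihull_halfspace_le[OF c(2)]]
    by (simp_all only: interior_halfspace_ge interior_halfspace_le not_False_eq_True)
  then show ?thesis by fastforce
qed

text \<open>The intersection lies in the plane at height \<open>c\<close>, which cuts a face out of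
  \<open>ihull t'\<close>, spanned by some of its vertices. As \<open>c\<close> is attained on
  \<open>t\<close>, the rule for ties makes these vertices common.\<close>

lemma separates_properly_Int:
  assumes "separates_properly f t t'" "t \<noteq> []"
  shows "ihull t \<inter> ihull t' = convex hull (emb ` (set t \<inter> set t'))"
proof
  show "convex hull (emb ` (set t \<inter> set t')) \<subseteq> ihull t \<inter> ihull t'"
    by (simp add: hull_mono image_mono)
  have sep: "separates f t t'"
    using assms(1) by (force simp: separates_def separates_properly_def list_all_iff)
  obtain c where c: "\<forall>v\<in>set t. c \<le> dot3 f v" "\<forall>u\<in>set t'. dot3 f u \<le> c"
      and "\<exists>v\<in>set t. dot3 f v = c"
    by (rule separating_value[OF sep assms(2)])
  then obtain v where v: "v \<in> set t" "dot3 f v = c" by blast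
  have F: "ihull t' \<inter> {x. emb f \<bullet> x = of_int c} face_of ihull t'"
    using ihull_halfspace_le[OF c(2)] by (intro face_of_Int_supporting_hyperplane_le) auto
  obtain C where C: "C \<subseteq> emb ` set t'" "ihull t' \<inter> {x. emb f \<bullet> x = of_int c} = convex hull C"
    by (rule face_of_convex_hull_subset[OF finite_imp_compact F]) simp
  have "C \<subseteq> emb ` (set t \<inter> set t')"
  proof
    fix x assume "x \<in> C"
    then obtain u where u: "u \<in> set t'" "x = emb u" using C(1) by blast
    have "x \<in> convex hull C" using \<open>x \<in> C\<close> by (rule hull_inc)
    then have "dot3 f u = c"
      using u unfolding C(2)[symmetric] by (simp add: emb_dot)
    then have "u \<in> set t"
      using assms(1) u(1) v by (force simp: separates_properly_def list_all_iff)
    with u show "x \<in> emb ` (set t \<inter> set t')" by blast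
  qed
  then have "convex hull C \<subseteq> convex hull (emb ` (set t \<inter> set t'))"
    by (rule hull_mono)
  moreover have "ihull t \<inter> ihull t' \<subseteq> convex hull C"
    unfolding C(2)[symmetric] using ihull_halfspace_ge[OF c(1)] ihull_halfspace_le[OF c(2)] by force
  ultimately show "ihull t \<inter> ihull t' \<subseteq> convex hull (emb ` (set t \<inter> set t'))"
    by blast
qed

section \<open>The volume criterion for dissections\<close>

lemma sorted_wrt_symmetric:
  assumes "sorted_wrt R c" "x \<in> set c" "y \<in> set c" "x \<noteq> y"
  shows "R x y \<or> R y x"
  using assms by (induction c) auto

text \<open>Filtering \<open>V\<close> reproduces \<open>t\<close> only if \<open>t\<close> is a
  subsequence of \<open>V\<close>; this certifies membership in \<open>tets V\<close> without
  generating all subsequences.\<close>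

definition is_tet :: "ipoint list \<Rightarrow> ipoint list \<Rightarrow> bool" where
  "is_tet V t \<longleftrightarrow> vol4 t \<noteq> 0 \<and> filter (\<lambda>v. v \<in> set t) V = t"

lemma filter_in_subseqs: "filter R V \<in> set (subseqs V)"
  by (induction V) (auto simp: Let_def)

lemma is_tet_in_tets: "is_tet V t \<Longrightarrow> t \<in> set (tets V)"
  using filter_in_subseqs[of "\<lambda>v. v \<in> set t" V] by (simp add: is_tet_def tets_def)

text \<open>The zero functional weakly separates everything, hence its exclusion.
  \<open>N / 6\<close> is to be an upper bound on the volume of the polytope.\<close>

definition dissection_check :: "ipoint list \<Rightarrow> ipoint list \<Rightarrow> int \<Rightarrow> ipoint list list \<Rightarrow> bool" where
  "dissection_check V fs N c \<longleftrightarrow> distinct c \<and> list_all (is_tet V) c \<and>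
     (0, 0, 0) \<notin> set fs \<and> sorted_wrt (separable separates fs) c \<and>
     sum_list (map (\<lambda>t. \<bar>vol4 t\<bar>) c) = N"

definition triangulation_check :: "ipoint list \<Rightarrow> ipoint list list \<Rightarrow> bool" where
  "triangulation_check fs c \<longleftrightarrow> sorted_wrt (separable separates_properly fs) c"

lemma sum_measure_ihull:
  assumes "distinct V" "distinct c" "set c \<subseteq> set (tets V)"
  shows "(\<Sum>T\<in>ihull ` set c. measure lebesgue T) = of_int (sum_list (map (\<lambda>t. \<bar>vol4 t\<bar>) c)) / 6"
proof -
  have "(\<Sum>T\<in>ihull ` set c. measure lebesgue T) = (\<Sum>t\<in>set c. measure lebesgue (ihull t))"
    using inj_on_subset[OF inj_on_ihull_tets[OF assms(1)] assms(3)] by (simp add: sum.reindex)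
  also have "\<dots> = (\<Sum>t\<in>set c. of_int \<bar>vol4 t\<bar> / 6)"
    using assms(3) by (intro sum.cong) (auto simp: vol4_measure tetsD)
  also have "\<dots> = of_int (sum_list (map (\<lambda>t. \<bar>vol4 t\<bar>) c)) / 6"
    using assms(2) by (simp add: sum_list_distinct_conv_sum_set sum_divide_distrib)
  finally show ?thesis .
qed

text \<open>A point of \<open>P\<close> outside \<open>U\<close> has a neighbourhood that avoids
  \<open>U\<close>, and it lies in the closure of the interior of \<open>P\<close>. So a nonempty
  open part of \<open>P\<close>, of positive measure, would be missing from
  \<open>U\<close>.\<close>

lemma closed_subset_full_measure:
  fixes P U :: "(real^3) set"
  assumes "convex P" "compact P" "interior P \<noteq> {}" "closed U" "U \<subseteq> P" and U: "U \<in> lmeasurable"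
    and le: "measure lebesgue P \<le> measure lebesgue U"
  shows "U = P"
proof (rule ccontr)
  assume "U \<noteq> P"
  with \<open>U \<subseteq> P\<close> obtain x where x: "x \<in> P" "x \<in> - U" by blast
  define W where "W = interior P \<inter> - U"
  have "x \<in> closure (interior P)"
    using x(1) convex_closure_interior[OF \<open>convex P\<close> \<open>interior P \<noteq> {}\<close>] closure_subset by blast
  moreover have "open (- U)"
    using \<open>closed U\<close> by (simp add: open_Compl)
  ultimately have "- U \<inter> interior P \<noteq> {}"
    using x(2) open_Int_closure_eq_empty[of "- U" "interior P"] by blast
  then have "W \<noteq> {}" by (auto simp: W_def)
  have "open W"
    using \<open>open (- U)\<close> by (simp add: W_def open_Int)
  have "W \<subseteq> P"
    using interior_subset[of P] by (auto simp: W_def)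
  have W: "W \<in> lmeasurable"
    using \<open>open W\<close> bounded_subset[OF compact_imp_bounded[OF \<open>compact P\<close>] \<open>W \<subseteq> P\<close>]
    by (intro lmeasurable_open)
  have "measure lebesgue W \<noteq> 0"
    using negligible_iff_measure0[OF W] open_not_negligible[OF \<open>open W\<close> \<open>W \<noteq> {}\<close>] by blast
  then have "0 < measure lebesgue W"
    by (simp add: zero_less_measure_iff)
  moreover have "measure lebesgue (W \<union> U) = measure lebesgue W + measure lebesgue U"
    by (rule measure_Union[OF _ _ fmeasurableD[OF W] fmeasurableD[OF U]])
      (use fmeasurableD2[OF W] fmeasurableD2[OF U] in \<open>auto simp: W_def infinity_ennreal_def\<close>)
  moreover have "measure lebesgue (W \<union> U) \<le> measure lebesgue P"
    using \<open>U \<subseteq> P\<close> \<open>W \<subseteq> P\<close> W \<open>U \<in> lmeasurable\<close> lmeasurable_compact[OF \<open>compact P\<close>]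
    by (intro measure_mono_fmeasurable) (auto simp: fmeasurableD)
  ultimately show False
    using le by linarith
qed

text \<open>Convex sets with disjoint interiors meet in a null set, so the volumes add up to
  \<open>N / 6\<close>, which by \<open>vol\<close> exhausts the polytope; a closed subset of full
  measure is all of it.\<close>

lemma dissectionI:
  assumes V: "distinct V" "vertices_of (ihull V) = emb ` set V"
    and vol: "measure lebesgue (ihull V) \<le> of_int N / 6" "0 < N"
    and check: "dissection_check V fs N c"
  shows "dissection (ihull ` set c) (ihull V)" "card (ihull ` set c) = length c"
proof -
  let ?D = "ihull ` set c" and ?P = "ihull V"
  have c: "distinct c" "set c \<subseteq> set (tets V)" "sum_list (map (\<lambda>t. \<bar>vol4 t\<bar>) c) = N"
    using check by (auto simp: dissection_check_def list_all_iff is_tet_in_tets)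
  have inj: "inj_on ihull (set c)"
    using inj_on_subset[OF inj_on_ihull_tets[OF V(1)] c(2)] .
  show "card ?D = length c"
    using c(1) by (simp add: card_image[OF inj] distinct_card)
  have ne: "t \<noteq> []" if "t \<in> set c" for t
    using tetsD(1)[OF subsetD[OF c(2) that]] by auto
  have disj: "pairwise (\<lambda>S T. interior S \<inter> interior T = {}) ?D"
  proof (rule pairwise_imageI)
    fix t t' assume t: "t \<in> set c" "t' \<in> set c" "t \<noteq> t'"
    then have "separable separates fs t t' \<or> separable separates fs t' t"
      using check sorted_wrt_symmetric[of "separable separates fs" c t t']
      by (simp add: dissection_check_def)
    then obtain f where f: "f \<in> set fs" "separates f t t' \<or> separates f t' t"
      by (auto simp: separable_iff)
    have "f \<noteq> (0, 0, 0)"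
      using f(1) check by (auto simp: dissection_check_def)
    then show "interior (ihull t) \<inter> interior (ihull t') = {}"
      using f(2) separates_interior_disjoint[of f t t'] separates_interior_disjoint[of f t' t] ne t
      by blast
  qed
  have sub: "\<Union>?D \<subseteq> ?P"
    using c(2) ihull_mono tetsD(2) by blast
  have "pairwise (\<lambda>S T. negligible (S \<inter> T)) ?D"
    using disj unfolding pairwise_def
    by (auto simp: negligible_convex_interior convex_Int interior_Int)
  then have "measure lebesgue (\<Union>?D) = (\<Sum>T\<in>?D. measure lebesgue T)"
    by (intro measure_negligible_finite_Union) auto
  also have "\<dots> = of_int N / 6"
    using sum_measure_ihull[OF V(1) c(1,2)] c(3) by simp
  finally have meas: "measure lebesgue (\<Union>?D) = of_int N / 6" .
  have lm: "\<Union>?D \<in> lmeasurable"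
    by (intro fmeasurable.finite_Union) auto
  have cl: "closed (\<Union>?D)"
    by (intro closed_Union) (auto intro: compact_imp_closed)
  have int: "interior ?P \<noteq> {}"
  proof -
    \<comment> \<open>A positive total \<open>N\<close> rules out an empty \<open>c\<close>.\<close>
    obtain t where "t \<in> set c"
      using c(3) vol(2) by (cases c) auto
    then show ?thesis
      using vol4_interior[of t] tetsD[of t V] c(2) interior_mono[OF ihull_mono[of t V]] by blast
  qed
  have "\<Union>?D = ?P"
    using closed_subset_full_measure[OF convex_ihull compact_ihull int cl sub lm] vol(1) meas by simp
  moreover have "3 simplex T \<and> vertices_of T \<subseteq> vertices_of ?P" if T: "T \<in> ?D" for T
  proof -
    obtain t where t: "t \<in> set (tets V)" "T = ihull t" using T c(2) by blast
    show ?thesis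
      using vol4_simplex[OF tetsD(1)[OF t(1)]] image_mono[OF tetsD(2)[OF t(1)], of emb]
      unfolding t(2) V(2) vol4_vertices[OF tetsD(1)[OF t(1)]] by blast
  qed
  ultimately show "dissection ?D ?P"
    unfolding dissection_def using disj by blast
qed

text \<open>Any subset of the vertices of a simplex spans a face of it, in particular the common
  vertices.\<close>

lemma triangulationI:
  assumes diss: "dissection (ihull ` set c) P" and check: "triangulation_check fs c"
    and c: "set c \<subseteq> set (tets V)"
  shows "triangulation_of (ihull ` set c) P"
proof -
  have "(ihull t \<inter> ihull t') face_of ihull t" if t: "t \<in> set c" "t' \<in> set c" for t t'
  proof (cases "t = t'")
    case True
    then show ?thesis by (simp add: face_of_refl)
  next
    case False
    have ne: "t \<noteq> []" "t' \<noteq> []"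
      using tetsD(1)[OF subsetD[OF c t(1)]] tetsD(1)[OF subsetD[OF c t(2)]] by auto
    have "separable separates_properly fs t t' \<or> separable separates_properly fs t' t"
      using check sorted_wrt_symmetric[of "separable separates_properly fs" c t t'] t False
      by (simp add: triangulation_check_def)
    then obtain f where "separates_properly f t t' \<or> separates_properly f t' t"
      by (auto simp: separable_iff)
    then have "ihull t \<inter> ihull t' = convex hull (emb ` (set t \<inter> set t'))"
      using separates_properly_Int[of f t t'] separates_properly_Int[of f t' t] ne
      by (metis Int_commute)
    moreover have "emb ` (set t \<inter> set t') \<subseteq> emb ` set t" by blast
    ultimately show ?thesis
      using face_of_convex_hull_affine_independent vol4_affine_independent(1) tetsD(1) c t(1)
      by (metis subsetD)
  qed
  then show ?thesis
    using diss unfolding triangulation_of_def triangulation_def dissection_def by auto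
qed

text \<open>A face that contains a point of the open segment from \<open>a\<close> to
  \<open>b\<close> contains both ends, but \<open>T'\<close> does not contain
  \<open>a\<close>.\<close>

lemma not_triangulation:
  assumes "T \<in> D" "T' \<in> D" "a \<in> T" "b \<in> T" "a \<noteq> b" "midpoint a b \<in> T'" "a \<notin> T'"
  shows "\<not> triangulation D"
proof
  assume "triangulation D"
  then have "(T \<inter> T') face_of T" and "\<exists>n. n simplex T"
    using assms(1,2) by (auto simp: triangulation_def)
  moreover from this have "convex T"
    using convex_simplex by blast
  moreover have "midpoint a b \<in> open_segment a b"
    using assms(5) by simp
  moreover have "midpoint a b \<in> T"
    using \<open>convex T\<close> assms(3,4) by (simp add: convexD_alt midpoint_def convex_def scaleR_add_right)
  ultimately show False
    using assms unfolding face_of_def by blast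
qed

text \<open>Subadditivity suffices, so the covering tetrahedra may overlap.\<close>

lemma ihull_measure_le:
  assumes "distinct V" "distinct c" "set c \<subseteq> set (tets V)" "ihull V \<subseteq> \<Union>(ihull ` set c)"
  shows "measure lebesgue (ihull V) \<le> of_int (sum_list (map (\<lambda>t. \<bar>vol4 t\<bar>) c)) / 6"
proof -
  have "measure lebesgue (ihull V) \<le> measure lebesgue (\<Union>(ihull ` set c))"
    using assms(4) by (intro measure_mono_fmeasurable fmeasurable.finite_Union) (auto simp: fmeasurableD)
  also have "\<dots> \<le> (\<Sum>T\<in>ihull ` set c. measure lebesgue T)"
    by (intro measure_Union_le) (auto simp: fmeasurableD)
  finally show ?thesis
    using sum_measure_ihull[OF assms(1-3)] by simp
qed

section \<open>Vertices, crossing edges and extremality\<close>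

definition extreme_check :: "ipoint list \<Rightarrow> ipoint list \<Rightarrow> bool" where
  "extreme_check fs V \<longleftrightarrow>
     list_all (\<lambda>v. list_ex (\<lambda>f. list_all (\<lambda>u. u = v \<or> dot3 f v < dot3 f u) V) fs) V"

text \<open>A functional with a strict minimum at \<open>v\<close> keeps \<open>v\<close> out of the
  hull of the other points.\<close>

lemma vertices_of_ihull:
  assumes "extreme_check fs V"
  shows "vertices_of (ihull V) = emb ` set V"
proof
  show "vertices_of (ihull V) \<subseteq> emb ` set V"
    by (auto simp: vertices_of_def dest: extreme_point_of_convex_hull)
  show "emb ` set V \<subseteq> vertices_of (ihull V)"
  proof clarify
    fix v assume v: "v \<in> set V"
    then obtain f where f: "\<forall>u\<in>set V. u = v \<or> dot3 f v < dot3 f u"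
      using assms by (auto simp: extreme_check_def list_all_iff list_ex_iff)
    let ?S = "emb ` (set V - {v})"
    have "convex hull ?S \<subseteq> {x. emb f \<bullet> x > of_int (dot3 f v)}"
      using f by (intro hull_minimal[where S = convex, OF _ convex_halfspace_gt]) (auto simp: emb_dot)
    then have "emb v \<notin> convex hull ?S"
      by (auto simp: emb_dot)
    then have "emb v extreme_point_of (convex hull (insert (emb v) ?S))"
      by (intro extreme_point_of_convex_hull_insert) auto
    moreover have "insert (emb v) ?S = emb ` set V"
      using v by auto
    ultimately show "emb v \<in> vertices_of (ihull V)"
      by (simp add: vertices_of_def)
  qed
qed

lemma ihull_image_neq:
  assumes "distinct V" "list_all (is_tet V) c" "list_all (is_tet V) c'" "t \<in> set c" "t \<notin> set c'"
  shows "ihull ` set c \<noteq> ihull ` set c'"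
proof -
  have "set c \<subseteq> set (tets V)" "set c' \<subseteq> set (tets V)"
    using assms(2,3) is_tet_in_tets by (auto simp: list_all_iff)
  then have "ihull ` set c = ihull ` set c' \<longleftrightarrow> set c = set c'"
    by (rule inj_on_image_eq_iff[OF inj_on_ihull_tets[OF assms(1)]])
  with assms(4,5) show ?thesis by metis
qed

lemma emb_add: "emb (a + b) = emb a + emb b"
  by (cases a; cases b) (simp add: vec_eq_iff forall_3)

text \<open>\<open>a + b = p + q\<close> says that the two segments bisect each other. A vertex of
  the polytope lying in \<open>ihull t'\<close> is extreme there too and hence belongs to
  \<open>t'\<close>; this keeps \<open>a\<close> outside.\<close>

lemma ihull_crossing_edges:
  assumes "t \<in> set c" "t' \<in> set c" "vol4 t' \<noteq> 0" "set t' \<subseteq> set V" "vertices_of (ihull V) = emb ` set V"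
    and "a \<in> set t" "b \<in> set t" "p \<in> set t'" "q \<in> set t'" "a + b = p + q"
    and "a \<noteq> b" "a \<notin> set t'" "a \<in> set V"
  shows "\<not> triangulation (ihull ` set c)"
proof (rule not_triangulation[of "ihull t" _ "ihull t'"])
  show "emb a \<in> ihull t" "emb b \<in> ihull t"
    using assms(6,7) by (simp_all add: hull_inc)
  have "midpoint (emb a) (emb b) = midpoint (emb p) (emb q)"
    using emb_add[of a b] emb_add[of p q] assms(10) by (simp add: midpoint_def)
  also have "\<dots> \<in> closed_segment (emb p) (emb q)"
    by simp
  also have "\<dots> \<subseteq> ihull t'"
    using assms(8,9) by (intro closed_segment_subset convex_ihull) (simp_all add: hull_inc)
  finally show "midpoint (emb a) (emb b) \<in> ihull t'" .
  show "emb a \<notin> ihull t'"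
  proof
    assume "emb a \<in> ihull t'"
    moreover have "emb a extreme_point_of ihull V"
      using assms(5,13) by (auto simp: vertices_of_def)
    ultimately have "emb a extreme_point_of ihull t'"
      using ihull_mono[OF assms(4)] by (auto simp: extreme_point_of_def)
    then have "emb a \<in> emb ` set t'"
      by (rule extreme_point_of_convex_hull)
    with assms(12) show False by auto
  qed
qed (use assms in auto)

lemma aff_dim_ihull:
  assumes "is_tet V t"
  shows "aff_dim (ihull V) = 3"
  using vol4_interior[OF tetsD(1)[OF is_tet_in_tets[OF assms]]]
    interior_mono[OF ihull_mono[OF tetsD(2)[OF is_tet_in_tets[OF assms]]]]
    aff_dim_nonempty_interior[of "ihull V"] by auto

lemma unique_maximal_dissection:
  assumes "dissection E P" "\<And>D. dissection D P \<Longrightarrow> card D < card E \<or> D = E"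
  shows "maximal_dissection D P \<longleftrightarrow> D = E"
  using assms unfolding maximal_dissection_def is_arg_max_def by (metis less_irrefl not_less_iff_gr_or_eq)

lemma unique_minimal_dissection:
  assumes "dissection E P" "\<And>D. dissection D P \<Longrightarrow> card E < card D \<or> D = E"
  shows "minimal_dissection D P \<longleftrightarrow> D = E"
  using assms unfolding minimal_dissection_def is_arg_min_def by (metis less_irrefl not_less_iff_gr_or_eq)

lemma maximal_triangulation_iff:
  assumes "triangulation_of E P" "\<And>D. triangulation_of D P \<Longrightarrow> card D \<le> card E"
  shows "maximal_triangulation D P \<longleftrightarrow> triangulation_of D P \<and> card D = card E"
  using assms unfolding maximal_triangulation_def is_arg_max_def by (metis antisym_conv3 linorder_not_less)

lemma minimal_triangulation_iff:
  assumes "triangulation_of E P" "\<And>D. triangulation_of D P \<Longrightarrow> card E \<le> card D"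
  shows "minimal_triangulation D P \<longleftrightarrow> triangulation_of D P \<and> card D = card E"
  using assms unfolding minimal_triangulation_def is_arg_min_def by (metis antisym_conv3 linorder_not_less)

lemma severalI: "Q x \<Longrightarrow> Q y \<Longrightarrow> x \<noteq> y \<Longrightarrow> several Q"
  unfolding several_def by blast

subsection \<open>The two polytopes\<close>

definition verts1 :: "ipoint list" where
  "verts1 =
    [(0,0,0), (1,0,0), (0,1,0), (1,1,0), (-1,0,1), (1,1,1), (0,1,-1), (2,0,-1)]"

definition verts2 :: "ipoint list" where
  "verts2 =
    [(1,0,0), (1,0,1), (-1,0,0), (-1,0,-1), (0,1,1), (1,1,1), (0,1,-1), (-1,1,-1)]"

text \<open>Certificates only: the checks themselves find, for every pair of tetrahedra, a
  functional in this list that separates it.\<close>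

definition separators1 :: "ipoint list" where
  "separators1 =
    [(0,0,1), (1,0,0), (1,0,1), (1,1,1), (1,-1,1), (0,1,1), (0,1,-1), (1,2,-2), (1,-2,-2),
     (1,1,0), (1,-1,0), (1,-2,1), (1,2,1), (0,1,2), (0,1,-2), (1,1,-2), (2,1,1), (1,-1,-2),
     (2,-1,1), (1,0,-1), (1,-2,0), (1,2,0), (2,0,1), (1,0,-2), (2,0,-1), (1,1,2), (1,-1,2),
     (1,2,-3), (2,1,-3), (1,-2,-3), (2,-1,-3), (1,1,-1), (2,1,0), (1,-1,-1), (2,-1,0),
     (2,1,-1), (2,-1,-1), (2,2,1), (2,3,0), (1,2,2), (2,1,-2), (2,1,2), (2,-2,1), (2,-3,0),
     (1,-2,2), (2,-1,-2), (2,-1,2), (2,3,2), (2,4,1), (2,-3,2), (2,-4,1)]"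

definition separators2 :: "ipoint list" where
  "separators2 =
    [(1,0,-1), (0,2,-1), (3,-1,-2), (1,-1,0), (2,0,-1), (2,-2,-1), (2,2,-3), (1,0,-2),
     (3,3,-4), (1,1,0), (0,2,1), (1,-2,0), (1,2,-2), (3,0,-2), (2,1,-3), (0,1,-1), (1,1,-1),
     (2,1,-2), (3,-1,-1), (2,-3,0), (2,0,-3), (3,-2,-2), (0,1,1), (1,-2,1), (0,3,-2),
     (1,3,-2), (1,-4,1), (4,-3,-3), (1,2,0), (1,-1,-1), (2,-1,-1), (1,1,-2), (1,-2,-2),
     (2,2,-1), (1,-3,1), (2,-1,-2), (2,-1,-3), (3,1,-2), (3,-3,-1), (3,-3,-2), (2,3,-3)]"

text \<open>The probe points, to be divided by 10, were found by a randomised search.\<close>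

definition probes1 :: "ipoint list" where
  "probes1 =
    [(4,9,-7), (11,6,2), (5,8,-4), (12,7,1), (7,6,-2), (8,4,-3), (11,2,-4), (6,5,-2),
     (-7,2,6), (11,4,-2), (4,5,2), (7,5,1), (7,8,4), (3,8,-4), (3,5,-1), (8,4,3), (9,2,-4),
     (11,4,2), (2,4,-3), (-1,2,4), (-2,5,4), (-4,5,3), (5,8,4), (-3,3,1), (1,2,4), (2,5,1)]"

definition probes2 :: "ipoint list" where
  "probes2 =
    [(-5,2,1), (-1,5,1), (-5,4,-3), (-2,2,-1), (-2,7,2), (1,6,3), (-1,3,-2), (-7,2,-1),
     (2,3,-2), (3,2,4), (3,5,2), (3,5,7), (-7,7,-5), (-4,9,-2), (-6,3,-7), (3,8,4), (-8,3,-7),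
     (-7,5,-3), (-3,5,-7), (1,8,-3), (7,5,3), (5,6,7), (5,3,1)]"

text \<open>The last four are normals to the facets of the tetrahedron
  \<open>v\<^sub>1 v\<^sub>2 u\<^sub>1 u\<^sub>2\<close>; beyond these facets lie \<open>n\<close>,
  \<open>e\<close>, \<open>w\<close>, \<open>s\<close>, in this order and one each.\<close>

definition supports1 :: "ipoint list" where
  "supports1 =
    [(-1,-1,-1), (-1,-1,1), (0,-1,1), (0,1,-1), (-2,-4,1), (-2,4,-3), (2,-4,-1), (2,4,3)]"

definition supports2 :: "ipoint list" where
  "supports2 =
    [(-1,-1,-1), (-1,-1,1), (-1,1,-1), (-1,1,1), (0,1,1), (1,-1,-1), (1,-1,0), (1,1,-1)]"

definition triang11a :: "ipoint list list" where
  "triang11a =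
    [[(0,0,0),(1,0,0),(0,1,0),(1,1,1)], [(0,0,0),(1,0,0),(0,1,0),(0,1,-1)],
     [(0,0,0),(1,0,0),(-1,0,1),(1,1,1)], [(0,0,0),(1,0,0),(0,1,-1),(2,0,-1)],
     [(0,0,0),(0,1,0),(-1,0,1),(1,1,1)], [(0,0,0),(0,1,0),(-1,0,1),(0,1,-1)],
     [(1,0,0),(0,1,0),(1,1,0),(1,1,1)], [(1,0,0),(0,1,0),(1,1,0),(2,0,-1)],
     [(1,0,0),(0,1,0),(0,1,-1),(2,0,-1)], [(1,0,0),(1,1,0),(1,1,1),(2,0,-1)],
     [(0,1,0),(1,1,0),(0,1,-1),(2,0,-1)]]"

definition triang11b :: "ipoint list list" where
  "triang11b =
    [[(0,0,0),(1,0,0),(1,1,0),(1,1,1)], [(0,0,0),(1,0,0),(1,1,0),(0,1,-1)],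
     [(0,0,0),(1,0,0),(-1,0,1),(1,1,1)], [(0,0,0),(1,0,0),(0,1,-1),(2,0,-1)],
     [(0,0,0),(0,1,0),(1,1,0),(-1,0,1)], [(0,0,0),(0,1,0),(1,1,0),(0,1,-1)],
     [(0,0,0),(0,1,0),(-1,0,1),(0,1,-1)], [(0,0,0),(1,1,0),(-1,0,1),(1,1,1)],
     [(1,0,0),(1,1,0),(1,1,1),(2,0,-1)], [(1,0,0),(1,1,0),(0,1,-1),(2,0,-1)],
     [(0,1,0),(1,1,0),(-1,0,1),(1,1,1)]]"

text \<open>
  The last of these tetrahedra cuts the polytope into itself and the four others, one beyond each
  of its facets. This covering only serves to bound the volume of the polytope from above.
\<close>

definition corners1 :: "ipoint list list" where
  "corners1 =
    [[(0,0,0),(-1,0,1),(0,1,-1),(2,0,-1)], [(1,0,0),(-1,0,1),(1,1,1),(2,0,-1)],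
     [(0,1,0),(-1,0,1),(1,1,1),(0,1,-1)], [(1,1,0),(1,1,1),(0,1,-1),(2,0,-1)],
     [(-1,0,1),(1,1,1),(0,1,-1),(2,0,-1)]]"

text \<open>The diagonal \<open>s n\<close> is used above the plane of the parallelogram and
  \<open>e w\<close> below it, with five tetrahedra on either side and two across.
  \<open>triang11a\<close> keeps \<open>e w\<close> on both sides and \<open>triang11b\<close> keeps
  \<open>s n\<close>; on one side this leaves only four tetrahedra, one of them of double
  volume.\<close>

definition max_diss1 :: "ipoint list list" where
  "max_diss1 =
    [[(0,0,0),(1,0,0),(0,1,0),(0,1,-1)], [(0,0,0),(1,0,0),(1,1,0),(1,1,1)],
     [(0,0,0),(1,0,0),(-1,0,1),(1,1,1)], [(0,0,0),(1,0,0),(0,1,-1),(2,0,-1)],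
     [(0,0,0),(0,1,0),(1,1,0),(-1,0,1)], [(0,0,0),(0,1,0),(-1,0,1),(0,1,-1)],
     [(0,0,0),(1,1,0),(-1,0,1),(1,1,1)], [(1,0,0),(0,1,0),(1,1,0),(2,0,-1)],
     [(1,0,0),(0,1,0),(0,1,-1),(2,0,-1)], [(1,0,0),(1,1,0),(1,1,1),(2,0,-1)],
     [(0,1,0),(1,1,0),(-1,0,1),(1,1,1)], [(0,1,0),(1,1,0),(0,1,-1),(2,0,-1)]]"

definition triang7a :: "ipoint list list" where
  "triang7a =
    [[(1,0,0),(1,0,1),(-1,0,-1),(1,1,1)], [(1,0,0),(-1,0,-1),(1,1,1),(0,1,-1)],
     [(1,0,1),(-1,0,0),(-1,0,-1),(0,1,1)], [(1,0,1),(-1,0,-1),(0,1,1),(1,1,1)],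
     [(-1,0,0),(-1,0,-1),(0,1,1),(-1,1,-1)], [(-1,0,-1),(0,1,1),(1,1,1),(-1,1,-1)],
     [(-1,0,-1),(1,1,1),(0,1,-1),(-1,1,-1)]]"

definition triang7b :: "ipoint list list" where
  "triang7b =
    [[(1,0,0),(1,0,1),(-1,0,-1),(1,1,1)], [(1,0,0),(-1,0,-1),(1,1,1),(0,1,-1)],
     [(1,0,1),(-1,0,0),(-1,0,-1),(0,1,1)], [(1,0,1),(-1,0,-1),(0,1,1),(1,1,1)],
     [(-1,0,0),(-1,0,-1),(0,1,1),(-1,1,-1)], [(-1,0,-1),(0,1,1),(1,1,1),(0,1,-1)],
     [(-1,0,-1),(0,1,1),(0,1,-1),(-1,1,-1)]]"

definition triang9a :: "ipoint list list" where
  "triang9a =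
    [[(1,0,0),(1,0,1),(-1,0,-1),(0,1,-1)], [(1,0,0),(1,0,1),(1,1,1),(0,1,-1)],
     [(1,0,1),(-1,0,0),(-1,0,-1),(1,1,1)], [(1,0,1),(-1,0,0),(0,1,1),(1,1,1)],
     [(1,0,1),(-1,0,-1),(1,1,1),(0,1,-1)], [(-1,0,0),(-1,0,-1),(0,1,1),(1,1,1)],
     [(-1,0,0),(-1,0,-1),(0,1,1),(-1,1,-1)], [(-1,0,-1),(0,1,1),(1,1,1),(-1,1,-1)],
     [(-1,0,-1),(1,1,1),(0,1,-1),(-1,1,-1)]]"

definition triang9b :: "ipoint list list" where
  "triang9b =
    [[(1,0,0),(1,0,1),(-1,0,-1),(1,1,1)], [(1,0,0),(-1,0,-1),(1,1,1),(-1,1,-1)],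
     [(1,0,0),(-1,0,-1),(0,1,-1),(-1,1,-1)], [(1,0,0),(1,1,1),(0,1,-1),(-1,1,-1)],
     [(1,0,1),(-1,0,0),(-1,0,-1),(1,1,1)], [(1,0,1),(-1,0,0),(0,1,1),(1,1,1)],
     [(-1,0,0),(-1,0,-1),(0,1,1),(1,1,1)], [(-1,0,0),(-1,0,-1),(0,1,1),(-1,1,-1)],
     [(-1,0,-1),(0,1,1),(1,1,1),(-1,1,-1)]]"

text \<open>The parallelogram \<open>s' w' n' e'\<close> lies in the plane x = z. Taking the
  diagonal \<open>s' n'\<close> on the side of \<open>u\<^sub>1'\<close> and
  \<open>u\<^sub>2'\<close>, and \<open>w' e'\<close> on the other, three tetrahedra fill each
  side.\<close>

definition min_diss2 :: "ipoint list list" where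
  "min_diss2 =
    [[(1,0,0),(1,0,1),(-1,0,-1),(1,1,1)], [(1,0,0),(-1,0,-1),(1,1,1),(0,1,-1)],
     [(1,0,1),(-1,0,0),(-1,0,-1),(-1,1,-1)], [(1,0,1),(-1,0,0),(0,1,1),(-1,1,-1)],
     [(1,0,1),(0,1,1),(1,1,1),(-1,1,-1)], [(-1,0,-1),(1,1,1),(0,1,-1),(-1,1,-1)]]"

text \<open>The diagonals of \<open>min_diss2\<close> are exchanged, with five tetrahedra on each
  side of x = z. With \<open>s' n'\<close> on both sides, \<open>triang7a\<close> splits as 3 + 4
  and \<open>triang9a\<close> as 4 + 5.\<close>

definition max_diss2 :: "ipoint list list" where
  "max_diss2 =
    [[(1,0,0),(1,0,1),(-1,0,-1),(-1,1,-1)], [(1,0,0),(1,0,1),(1,1,1),(0,1,-1)],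
     [(1,0,0),(1,0,1),(0,1,-1),(-1,1,-1)], [(1,0,0),(-1,0,-1),(0,1,-1),(-1,1,-1)],
     [(1,0,1),(-1,0,0),(-1,0,-1),(1,1,1)], [(1,0,1),(-1,0,0),(0,1,1),(1,1,1)],
     [(1,0,1),(1,1,1),(0,1,-1),(-1,1,-1)], [(-1,0,0),(-1,0,-1),(0,1,1),(1,1,1)],
     [(-1,0,0),(-1,0,-1),(0,1,1),(-1,1,-1)], [(-1,0,-1),(0,1,1),(1,1,1),(-1,1,-1)]]"

section \<open>Evaluation of the certificates\<close>

lemma verts1_extreme: "extreme_check supports1 verts1"
  by code_simp

lemma verts2_extreme: "extreme_check supports2 verts2"
  by code_simp

lemma triang11a_check: "dissection_check verts1 separators1 12 triang11a"
  by code_simp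

lemma triang11b_check: "dissection_check verts1 separators1 12 triang11b"
  by code_simp

lemma max_diss1_check: "dissection_check verts1 separators1 12 max_diss1"
  by code_simp

lemma triang7a_check: "dissection_check verts2 separators2 14 triang7a"
  by code_simp

lemma triang7b_check: "dissection_check verts2 separators2 14 triang7b"
  by code_simp

lemma triang9a_check: "dissection_check verts2 separators2 14 triang9a"
  by code_simp

lemma triang9b_check: "dissection_check verts2 separators2 14 triang9b"
  by code_simp

lemma min_diss2_check: "dissection_check verts2 separators2 14 min_diss2"
  by code_simp

lemma max_diss2_check: "dissection_check verts2 separators2 14 max_diss2"
  by code_simp

lemma triang11a_tri: "triangulation_check separators1 triang11a"
  by code_simp

lemma triang11b_tri: "triangulation_check separators1 triang11b"
  by code_simp

lemma triang7a_tri: "triangulation_check separators2 triang7a"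
  by code_simp

lemma triang7b_tri: "triangulation_check separators2 triang7b"
  by code_simp

lemma triang9a_tri: "triangulation_check separators2 triang9a"
  by code_simp

lemma triang9b_tri: "triangulation_check separators2 triang9b"
  by code_simp

lemma verts1_generic: "generic 10 verts1 probes1"
  by code_simp

lemma verts2_generic: "generic 10 verts2 probes2"
  by code_simp

text \<open>A cover of a nonempty list of probes cannot be empty, so \<open>lo = 0\<close> lets
  every size up to eleven pass; any larger cover must be \<open>max_diss1\<close>.\<close>

lemma verts1_table: "table_check (size_check [max_diss1] 0 12) (length probes1) (incidence 10 verts1 probes1)"
  by code_simp

text \<open>The bounds are strict: sizes 7 to 9 pass, and any other cover must be one of the two
  extremal dissections.\<close>

lemma verts2_table: "table_check (size_check [min_diss2, max_diss2] 6 10) (length probes2) (incidence 10 verts2 probes2)"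
  by code_simp

section \<open>Facets, coverings and integer points\<close>

lemma ihull_verts1_ineqs:
  assumes "x \<in> ihull verts1"
  shows "0 \<le> x $ 2" "x $ 2 \<le> 1" "x $ 1 - x $ 2 \<ge> - 1" "x $ 1 + x $ 2 \<le> 2"
    "x $ 1 + 2 * x $ 2 - x $ 3 \<le> 3" "x $ 1 - x $ 2 + x $ 3 \<le> 1" "x $ 1 - 2 * x $ 2 + 2 * x $ 3 \<le> 1"
    "x $ 1 - 2 * x $ 2 - x $ 3 \<ge> - 2" "x $ 1 + x $ 2 + x $ 3 \<ge> 0" "x $ 1 + 2 * x $ 2 + 2 * x $ 3 \<ge> 0"
proof -
  have *: "of_int c \<le> emb f \<bullet> x" if "\<forall>v\<in>set verts1. c \<le> dot3 f v" for f c
    using ihull_halfspace_ge[OF that] assms by blast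
  show "0 \<le> x $ 2" "x $ 2 \<le> 1" "x $ 1 - x $ 2 \<ge> - 1" "x $ 1 + x $ 2 \<le> 2"
    "x $ 1 + 2 * x $ 2 - x $ 3 \<le> 3" "x $ 1 - x $ 2 + x $ 3 \<le> 1" "x $ 1 - 2 * x $ 2 + 2 * x $ 3 \<le> 1"
    "x $ 1 - 2 * x $ 2 - x $ 3 \<ge> - 2" "x $ 1 + x $ 2 + x $ 3 \<ge> 0" "x $ 1 + 2 * x $ 2 + 2 * x $ 3 \<ge> 0"
    using *[of 0 "(0, 1, 0)"] *[of "-1" "(0, -1, 0)"] *[of "-1" "(1, -1, 0)"] *[of "-2" "(-1, -1, 0)"]
      *[of "-3" "(-1, -2, 1)"] *[of "-1" "(-1, 1, -1)"] *[of "-1" "(-1, 2, -2)"]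
      *[of "-2" "(1, -2, -1)"] *[of 0 "(1, 1, 1)"] *[of 0 "(1, 2, 2)"]
    by (simp_all add: verts1_def inner_vec_def sum_3)
qed

lemma ihull_verts1_cover: "ihull verts1 \<subseteq> \<Union>(ihull ` set corners1)"
proof
  fix x assume "x \<in> ihull verts1"
  note ineqs = ihull_verts1_ineqs[OF this]
  have "list_ex (\<lambda>t. x \<in> ihull t) corners1"
    \<comment> \<open>\<open>list_ex\<close> unfolds to a disjunction over tetrahedra, each given by
      four linear inequalities. Rewriting with \<open>list.set\<close> would destroy the form that
      \<open>ihull_4_iff\<close> expects.\<close>
    using ineqs by (simp add: corners1_def ihull_4_ineqs algebra_simps del: list.set) (smt (verit))
  then show "x \<in> \<Union>(ihull ` set corners1)"
    by (simp only: list_ex_iff UN_iff)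
qed

text \<open>As for the first polytope, these are the ten facets: two quadrilaterals in
  \<open>x $ 2 = 0\<close> and \<open>x $ 2 = 1\<close>, and eight triangles.\<close>

lemma ihull_verts2_ineqs:
  assumes "x \<in> ihull verts2"
  shows "0 \<le> x $ 2" "x $ 2 \<le> 1" "- 1 \<le> x $ 1" "x $ 1 \<le> 1" "- 1 \<le> x $ 3" "x $ 3 \<le> 1"
    "2 * x $ 1 + x $ 2 - x $ 3 \<le> 2" "x $ 1 - x $ 2 - 2 * x $ 3 \<le> 1"
    "x $ 1 + x $ 2 - 2 * x $ 3 \<ge> - 1" "2 * x $ 1 - x $ 2 - x $ 3 \<ge> - 2"
proof -
  have *: "of_int c \<le> emb f \<bullet> x" if "\<forall>v\<in>set verts2. c \<le> dot3 f v" for f c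
    using ihull_halfspace_ge[OF that] assms by blast
  show "0 \<le> x $ 2" "x $ 2 \<le> 1" "- 1 \<le> x $ 1" "x $ 1 \<le> 1" "- 1 \<le> x $ 3" "x $ 3 \<le> 1"
    "2 * x $ 1 + x $ 2 - x $ 3 \<le> 2" "x $ 1 - x $ 2 - 2 * x $ 3 \<le> 1"
    "x $ 1 + x $ 2 - 2 * x $ 3 \<ge> - 1" "2 * x $ 1 - x $ 2 - x $ 3 \<ge> - 2"
    using *[of 0 "(0, 1, 0)"] *[of "-1" "(0, -1, 0)"] *[of "-1" "(1, 0, 0)"] *[of "-1" "(-1, 0, 0)"]
      *[of "-1" "(0, 0, 1)"] *[of "-1" "(0, 0, -1)"] *[of "-2" "(-2, -1, 1)"] *[of "-1" "(-1, 1, 2)"]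
      *[of "-1" "(1, 1, -2)"] *[of "-2" "(2, -1, -1)"]
    by (simp_all add: verts2_def inner_vec_def sum_3)
qed

text \<open>Here \<open>min_diss2\<close> itself serves as the covering that bounds the volume, by
  14/6.\<close>

lemma ihull_verts2_cover: "ihull verts2 \<subseteq> \<Union>(ihull ` set min_diss2)"
proof
  fix x assume "x \<in> ihull verts2"
  note ineqs = ihull_verts2_ineqs[OF this]
  have "list_ex (\<lambda>t. x \<in> ihull t) min_diss2"
    using ineqs by (simp add: min_diss2_def ihull_4_ineqs algebra_simps del: list.set) (smt (verit))
  then show "x \<in> \<Union>(ihull ` set min_diss2)"
    by (simp only: list_ex_iff UN_iff)
qed

text \<open>The facet inequalities leave two integer values for the second coordinate and three for
  the third, and then confine the first.\<close>

lemma verts1_integer_points: "ihull verts1 \<inter> integer_points = emb ` set verts1"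
proof
  show "emb ` set verts1 \<subseteq> ihull verts1 \<inter> integer_points"
    using hull_subset[of "emb ` set verts1" convex] by (auto simp: integer_points_def forall_3)
  show "ihull verts1 \<inter> integer_points \<subseteq> emb ` set verts1"
  proof
    fix x assume x: "x \<in> ihull verts1 \<inter> integer_points"
    then obtain a b c where "x $ 1 = of_int a" "x $ 2 = of_int b" "x $ 3 = of_int c"
      by (auto simp: integer_points_def forall_3 elim!: Ints_cases)
    then have eq: "x = emb (a, b, c)"
      by (simp add: vec_eq_iff forall_3)
    have "0 \<le> b" "b \<le> 1" "a - b \<ge> - 1" "a + b \<le> 2" "a + 2 * b - c \<le> 3" "a - b + c \<le> 1"
      "a - 2 * b + 2 * c \<le> 1" "a - 2 * b - c \<ge> - 2" "a + b + c \<ge> 0" "a + 2 * b + 2 * c \<ge> 0"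
      using ihull_verts1_ineqs[OF IntD1[OF x]] unfolding eq emb_component by linarith+
    moreover from calculation have "b = 0 \<or> b = 1" "c = - 1 \<or> c = 0 \<or> c = 1"
      by linarith+
    ultimately have "(a, b, c) \<in> set verts1"
      unfolding verts1_def by (elim disjE; hypsubst; simp; presburger)
    with eq show "x \<in> emb ` set verts1" by blast
  qed
qed

lemma verts1_distinct: "distinct verts1" and verts2_distinct: "distinct verts2"
  by code_simp+

lemmas verts1_vertices = vertices_of_ihull[OF verts1_extreme]
lemmas verts2_vertices = vertices_of_ihull[OF verts2_extreme]

lemma corners1_tets: "distinct corners1 \<and> list_all (is_tet verts1) corners1 \<and> sum_list (map (\<lambda>t. \<bar>vol4 t\<bar>) corners1) = 12"
  by code_simp

lemma min_diss2_tets: "distinct min_diss2 \<and> list_all (is_tet verts2) min_diss2 \<and> sum_list (map (\<lambda>t. \<bar>vol4 t\<bar>) min_diss2) = 14"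
  by code_simp

lemma verts1_measure: "measure lebesgue (ihull verts1) \<le> of_int 12 / 6"
proof -
  have "set corners1 \<subseteq> set (tets verts1)"
    using corners1_tets is_tet_in_tets by (auto simp: list_all_iff)
  then show ?thesis
    using ihull_measure_le[OF verts1_distinct _ _ ihull_verts1_cover] corners1_tets by metis
qed

lemma verts2_measure: "measure lebesgue (ihull verts2) \<le> of_int 14 / 6"
proof -
  have "set min_diss2 \<subseteq> set (tets verts2)"
    using min_diss2_tets is_tet_in_tets by (auto simp: list_all_iff)
  then show ?thesis
    using ihull_measure_le[OF verts2_distinct _ _ ihull_verts2_cover] min_diss2_tets by metis
qed

lemmas verts1_dissectionI = dissectionI[OF verts1_distinct verts1_vertices verts1_measure, simplified]
lemmas verts2_dissectionI = dissectionI[OF verts2_distinct verts2_vertices verts2_measure, simplified]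

lemma triangulation_checkI:
  assumes "dissection (ihull ` set c) P" "dissection_check V fs N c" "triangulation_check fs' c"
  shows "triangulation_of (ihull ` set c) P"
  using triangulationI[OF assms(1,3), of V] assms(2) is_tet_in_tets
  by (auto simp: dissection_check_def list_all_iff)

lemma max_diss1_not_triangulation: "\<not> triangulation (ihull ` set max_diss1)"
  by (rule ihull_crossing_edges[where t = "[(0,0,0), (1,0,0), (1,1,0), (1,1,1)]"
        and t' = "[(1,0,0), (0,1,0), (1,1,0), (2,0,-1)]" and V = verts1
        and a = "(0,0,0)" and b = "(1,1,0)" and p = "(1,0,0)" and q = "(0,1,0)", OF _ _ _ _ verts1_vertices])
    (simp_all add: max_diss1_def verts1_def)

lemma min_diss2_not_triangulation: "\<not> triangulation (ihull ` set min_diss2)"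
  by (rule ihull_crossing_edges[where t = "[(1,0,0), (1,0,1), (-1,0,-1), (1,1,1)]"
        and t' = "[(1,0,1), (0,1,1), (1,1,1), (-1,1,-1)]" and V = verts2
        and a = "(-1,0,-1)" and b = "(1,1,1)" and p = "(1,0,1)" and q = "(-1,1,-1)", OF _ _ _ _ verts2_vertices])
    (simp_all add: min_diss2_def verts2_def)

lemma max_diss2_not_triangulation: "\<not> triangulation (ihull ` set max_diss2)"
  by (rule ihull_crossing_edges[where t = "[(1,0,1), (-1,0,0), (-1,0,-1), (1,1,1)]"
        and t' = "[(1,0,1), (1,1,1), (0,1,-1), (-1,1,-1)]" and V = verts2
        and a = "(-1,0,-1)" and b = "(1,1,1)" and p = "(1,0,1)" and q = "(-1,1,-1)", OF _ _ _ _ verts2_vertices])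
    (simp_all add: max_diss2_def verts2_def)

lemma max_diss1_unimodular: "list_all (\<lambda>t. is_tet verts1 t \<and> \<bar>vol4 t\<bar> = 1) max_diss1"
  by code_simp

lemma triang11_tets: "list_all (is_tet verts1) triang11a \<and> list_all (is_tet verts1) triang11b \<and>
    length triang11a = 11 \<and> length triang11b = 11 \<and> length max_diss1 = 12 \<and>
    \<not> list_all (\<lambda>t. t \<in> set triang11b) triang11a"
  by code_simp

lemma extremal2_tets: "list_all (is_tet verts2) triang7a \<and> list_all (is_tet verts2) triang7b \<and> list_all (is_tet verts2) triang9a \<and>
    list_all (is_tet verts2) triang9b \<and> length min_diss2 = 6 \<and> length triang7a = 7 \<and> length triang7b = 7 \<and> length triang9a = 9 \<and>
    length triang9b = 9 \<and> length max_diss2 = 10 \<and> \<not> list_all (\<lambda>t. t \<in> set triang7b) triang7a \<and> \<not> list_all (\<lambda>t. t \<in> set triang9b) triang9a"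
  by code_simp

section \<open>Extremal dissections and triangulations of the two polytopes\<close>

lemma verts1_maximal_dissection: "maximal_dissection D (ihull verts1) \<longleftrightarrow> D = ihull ` set max_diss1"
  and verts1_maximal_triangulation:
    "maximal_triangulation D (ihull verts1) \<longleftrightarrow> triangulation_of D (ihull verts1) \<and> card D = 11"
proof -
  note max_diss1 = verts1_dissectionI[OF max_diss1_check]
  note triang11 = verts1_dissectionI[OF triang11a_check]
  have sizes: "card D < 12 \<or> D = ihull ` set max_diss1" if "dissection D (ihull verts1)" for D
    using dissection_sizes[OF verts1_distinct verts1_vertices _ verts1_generic verts1_table _ that] max_diss1 by auto
  show "maximal_dissection D (ihull verts1) \<longleftrightarrow> D = ihull ` set max_diss1"
    using sizes max_diss1 triang11_tets by (intro unique_maximal_dissection) auto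
  \<comment> \<open>Size 12 belongs to \<open>max_diss1\<close> alone, which is not a triangulation,
    so the bound drops to 11.\<close>
  have "card D \<le> card (ihull ` set triang11a)" if "triangulation_of D (ihull verts1)" for D
    using that sizes[of D] max_diss1_not_triangulation triang11(2) triang11_tets by (auto simp: triangulation_of_def)
  then show "maximal_triangulation D (ihull verts1) \<longleftrightarrow> triangulation_of D (ihull verts1) \<and> card D = 11"
    using maximal_triangulation_iff[OF triangulation_checkI[OF triang11(1) triang11a_check triang11a_tri]] triang11(2) triang11_tets
    by simp
qed

lemma verts1_several_maximal: "several (\<lambda>D. maximal_triangulation D (ihull verts1))"
proof -
  note triang11a = verts1_dissectionI[OF triang11a_check] and triang11b = verts1_dissectionI[OF triang11b_check]
  have "maximal_triangulation (ihull ` set triang11a) (ihull verts1)" "maximal_triangulation (ihull ` set triang11b) (ihull verts1)"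
    unfolding verts1_maximal_triangulation
    using triang11a(2) triang11b(2) triang11_tets triangulation_checkI[OF triang11a(1) triang11a_check triang11a_tri]
      triangulation_checkI[OF triang11b(1) triang11b_check triang11b_tri] by simp_all
  moreover have "ihull ` set triang11a \<noteq> ihull ` set triang11b"
    using triang11_tets ihull_image_neq[OF verts1_distinct, of triang11a triang11b] by (auto simp: list_all_iff)
  ultimately show ?thesis
    by (intro severalI)
qed

lemma verts1_unimodular: "T \<in> ihull ` set max_diss1 \<Longrightarrow> measure lebesgue T = 1 / 6"
  using max_diss1_unimodular vol4_measure by (auto simp: list_all_iff is_tet_def)

lemma verts2_sizes:
  assumes "dissection D (ihull verts2)"
  shows "6 < card D \<and> card D < 10 \<or> D = ihull ` set min_diss2 \<or> D = ihull ` set max_diss2"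
proof -
  have "card (ihull ` set E) = length E" if "E \<in> set [min_diss2, max_diss2]" for E
    using that verts2_dissectionI(2)[OF min_diss2_check] verts2_dissectionI(2)[OF max_diss2_check] by auto
  from dissection_sizes[OF verts2_distinct verts2_vertices _ verts2_generic verts2_table this assms] show ?thesis
    by auto
qed

lemma verts2_maximal_dissection: "maximal_dissection D (ihull verts2) \<longleftrightarrow> D = ihull ` set max_diss2"
  and verts2_minimal_dissection: "minimal_dissection D (ihull verts2) \<longleftrightarrow> D = ihull ` set min_diss2"
proof -
  note extremal2 = verts2_dissectionI[OF min_diss2_check] verts2_dissectionI[OF max_diss2_check]
  have cards: "card (ihull ` set min_diss2) = 6" "card (ihull ` set max_diss2) = 10"
    using extremal2(2,4) extremal2_tets by simp_all
  have "card D < card (ihull ` set max_diss2) \<or> D = ihull ` set max_diss2"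
      "card (ihull ` set min_diss2) < card D \<or> D = ihull ` set min_diss2" if "dissection D (ihull verts2)" for D
    using verts2_sizes[OF that] cards by (elim disjE; simp)+
  then show "maximal_dissection D (ihull verts2) \<longleftrightarrow> D = ihull ` set max_diss2"
    and "minimal_dissection D (ihull verts2) \<longleftrightarrow> D = ihull ` set min_diss2"
    using unique_maximal_dissection[OF extremal2(3)] unique_minimal_dissection[OF extremal2(1)] by simp_all
qed

text \<open>Sizes 6 and 10 belong to the two extremal dissections alone, and neither of these is a
  triangulation.\<close>

lemma verts2_triangulation_sizes:
  assumes "triangulation_of D (ihull verts2)"
  shows "7 \<le> card D" "card D \<le> 9"
  using verts2_sizes[of D] min_diss2_not_triangulation max_diss2_not_triangulation assms
  by (auto simp: triangulation_of_def)

lemma verts2_maximal_triangulation: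
    "maximal_triangulation D (ihull verts2) \<longleftrightarrow> triangulation_of D (ihull verts2) \<and> card D = 9"
  and verts2_minimal_triangulation:
    "minimal_triangulation D (ihull verts2) \<longleftrightarrow> triangulation_of D (ihull verts2) \<and> card D = 7"
proof -
  note triang9 = verts2_dissectionI[OF triang9a_check] and triang7 = verts2_dissectionI[OF triang7a_check]
  show "maximal_triangulation D (ihull verts2) \<longleftrightarrow> triangulation_of D (ihull verts2) \<and> card D = 9"
    using maximal_triangulation_iff[OF triangulation_checkI[OF triang9(1) triang9a_check triang9a_tri]] triang9(2) extremal2_tets
      verts2_triangulation_sizes by simp
  show "minimal_triangulation D (ihull verts2) \<longleftrightarrow> triangulation_of D (ihull verts2) \<and> card D = 7"
    using minimal_triangulation_iff[OF triangulation_checkI[OF triang7(1) triang7a_check triang7a_tri]] triang7(2) extremal2_tets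
      verts2_triangulation_sizes by simp
qed

lemma verts2_several_maximal: "several (\<lambda>D. maximal_triangulation D (ihull verts2))"
proof -
  note triang9a = verts2_dissectionI[OF triang9a_check] and triang9b = verts2_dissectionI[OF triang9b_check]
  have "maximal_triangulation (ihull ` set triang9a) (ihull verts2)" "maximal_triangulation (ihull ` set triang9b) (ihull verts2)"
    unfolding verts2_maximal_triangulation
    using triang9a(2) triang9b(2) extremal2_tets triangulation_checkI[OF triang9a(1) triang9a_check triang9a_tri]
      triangulation_checkI[OF triang9b(1) triang9b_check triang9b_tri] by simp_all
  moreover have "ihull ` set triang9a \<noteq> ihull ` set triang9b"
    using extremal2_tets ihull_image_neq[OF verts2_distinct, of triang9a triang9b] by (auto simp: list_all_iff)
  ultimately show ?thesis
    by (intro severalI)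
qed

lemma verts2_several_minimal: "several (\<lambda>D. minimal_triangulation D (ihull verts2))"
proof -
  note triang7a = verts2_dissectionI[OF triang7a_check] and triang7b = verts2_dissectionI[OF triang7b_check]
  have "minimal_triangulation (ihull ` set triang7a) (ihull verts2)" "minimal_triangulation (ihull ` set triang7b) (ihull verts2)"
    unfolding verts2_minimal_triangulation
    using triang7a(2) triang7b(2) extremal2_tets triangulation_checkI[OF triang7a(1) triang7a_check triang7a_tri]
      triangulation_checkI[OF triang7b(1) triang7b_check triang7b_tri] by simp_all
  moreover have "ihull ` set triang7a \<noteq> ihull ` set triang7b"
    using extremal2_tets ihull_image_neq[OF verts2_distinct, of triang7a triang7b] by (auto simp: list_all_iff)
  ultimately show ?thesis
    by (intro severalI)
qed

lemma card_emb: "distinct V \<Longrightarrow> card (emb ` set V) = length V"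
  by (simp add: card_image[OF inj_on_subset[OF inj_emb subset_UNIV]] distinct_card)

lemma aff_dim_verts1: "aff_dim (ihull verts1) = 3"
  using max_diss1_unimodular by (intro aff_dim_ihull[of _ "hd max_diss1"]) (simp add: max_diss1_def)

lemma aff_dim_verts2: "aff_dim (ihull verts2) = 3"
  using min_diss2_tets by (intro aff_dim_ihull[of _ "hd min_diss2"]) (simp add: min_diss2_def)

theorem proposition2p3:
  fixes s e w n v\<^sub>1 v\<^sub>2 u\<^sub>1 u\<^sub>2 :: "real^3"
    and s' e' w' n' v\<^sub>1' v\<^sub>2' u\<^sub>1' u\<^sub>2' :: "real^3"
    and V P V' P' :: "(real^3) set"
  assumes "s = vector [0, 0, 0]" and "e = vector [1, 0, 0]"
    and "w = vector [0, 1, 0]" and "n = vector [1, 1, 0]"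
    and "v\<^sub>1 = vector [-1, 0, 1]" and "v\<^sub>2 = vector [1, 1, 1]"
    and "u\<^sub>1 = vector [0, 1, -1]" and "u\<^sub>2 = vector [2, 0, -1]"
    and "V = {s, e, w, n, v\<^sub>1, v\<^sub>2, u\<^sub>1, u\<^sub>2}"
    and "P = convex hull V"
  assumes "u\<^sub>1' = vector [1, 0, 0]" and "w' = vector [1, 0, 1]"
    and "v\<^sub>1' = vector [-1, 0, 0]" and "s' = vector [-1, 0, -1]"
    and "v\<^sub>2' = vector [0, 1, 1]" and "n' = vector [1, 1, 1]"
    and "u\<^sub>2' = vector [0, 1, -1]" and "e' = vector [-1, 1, -1]"
    and "V' = {u\<^sub>1', w', v\<^sub>1', s', v\<^sub>2', n', u\<^sub>2', e'}"
    and "P' = convex hull V'"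
  shows
    "(card V = 8 \<and> aff_dim P = 3 \<and> vertices_of P = V \<and> P \<inter> integer_points = V \<and>
      (\<exists>!D. maximal_dissection D P) \<and>
      (\<forall>D. maximal_dissection D P \<longrightarrow>
         card D = 12 \<and> (\<forall>T\<in>D. measure lebesgue T = 1 / 6)) \<and>
      several (\<lambda>D. maximal_triangulation D P) \<and>
      (\<forall>D. maximal_triangulation D P \<longrightarrow> card D = 11))
     \<and>
     (card V' = 8 \<and> aff_dim P' = 3 \<and> vertices_of P' = V' \<and>
      (\<exists>!D. minimal_dissection D P') \<and>
      (\<forall>D. minimal_dissection D P' \<longrightarrow> card D = 6) \<and>
      several (\<lambda>D. minimal_triangulation D P') \<and>
      (\<forall>D. minimal_triangulation D P' \<longrightarrow> card D = 7) \<and>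
      several (\<lambda>D. maximal_triangulation D P') \<and>
      (\<forall>D. maximal_triangulation D P' \<longrightarrow> card D = 9) \<and>
      (\<exists>!D. maximal_dissection D P') \<and>
      (\<forall>D. maximal_dissection D P' \<longrightarrow> card D = 10))"
proof -
  have V: "V = emb ` set verts1"
    unfolding assms(1-9) by (simp add: verts1_def emb.simps)
  have V': "V' = emb ` set verts2"
    unfolding assms(11-19) by (simp add: verts2_def emb.simps)
  have P: "P = ihull verts1" and P': "P' = ihull verts2"
    unfolding assms(10,20) V V' by (rule refl)+
  have len: "length verts1 = 8" "length verts2 = 8"
    by (simp_all add: verts1_def verts2_def)
  show ?thesis
    \<comment> \<open>The characterisations reduce unique existence of an extremal dissection to
      equality with one explicit set.\<close>
    unfolding P P' V V' verts1_maximal_dissection verts2_maximal_dissection verts2_minimal_dissection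
      verts1_vertices verts2_vertices verts1_integer_points card_emb[OF verts1_distinct] card_emb[OF verts2_distinct]
      len aff_dim_verts1 aff_dim_verts2
    using verts1_several_maximal verts2_several_maximal verts2_several_minimal verts1_maximal_triangulation
      verts2_maximal_triangulation verts2_minimal_triangulation verts1_unimodular triang11_tets extremal2_tets
      verts1_dissectionI(2)[OF max_diss1_check] verts2_dissectionI(2)[OF min_diss2_check] verts2_dissectionI(2)[OF max_diss2_check]
    by simp
qed

end
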